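(* Let $q$ be a prime power and let $f(x)$ and $g(x)$ be two $q$-polynomials over $\mathbb{F}_{q^5}$, both with maximum field of linearity $\mathbb{F}_q$, such that $Im\,(f(x)/x)=Im\,(g(x)/x)$. Then either there exists $\varphi\in \Gamma\mathrm{L}(2,q^5)$ such that $f_\varphi(x)=\alpha x^{q^i}$ and $g_\varphi(x)=\beta x^{q^j}$ for some $i,j\in \{1,2,3,4\}$ and some $\alpha,\beta\in\mathbb{F}_{q^5}^*$ with $\mathrm{N}(\alpha)=\mathrm{N}(\beta)$, or there exists $\lambda\in \mathbb{F}_{q^5}^*$ such that $g(x)=f(\lambda x)/\lambda$ for all $x$, or $g(x)=\hat{f}(\lambda x)/\lambda$ for all $x$.
   Context: A $q$-polynomial over $\mathbb{F}_{q^n}$ is a polynomial $f(x)=\sum_{i=0}^{n-1}a_ix^{q^i}$ with $a_i\in\mathbb{F}_{q^n}$, regarded as an $\mathbb{F}_q$-linear map of $\mathbb{F}_{q^n}$. $Im\,(f(x)/x)$ denotes the set $\{f(x)/x : x\in\mathbb{F}_{q^n}^*\}$. The adjoint of $f$ is $\hat f(x)=\sum_{i=0}^{n-1}a_i^{q^{n-i}}x^{q^{n-i}}$ (exponents $q^n$ read as $q^0$). $\mathrm{N}(x)=x^{1+q+\dots+q^{n-1}}$ is the norm from $\mathbb{F}_{q^n}$ to $\mathbb{F}_q$ (here $n=5$). The maximum field of linearity of $f$ is the largest subfield $\mathbb{F}_{q^m}$ ($m\mid n$) of $\mathbb{F}_{q^n}$ such that $f(\mu x)=\mu f(x)$ for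 all $\mu\in\mathbb{F}_{q^m}$, $x\in\mathbb{F}_{q^n}$. An element $\varphi\in\Gamma\mathrm{L}(2,q^n)$ acts on $\mathbb{F}_{q^n}^2$ by $(x,y)\mapsto (ax^\sigma+by^\sigma,\ cx^\sigma+dy^\sigma)$, where $\begin{pmatrix}a&b\\c&d\end{pmatrix}$ is invertible over $\mathbb{F}_{q^n}$ (the linear part) and $\sigma$ is a field automorphism of $\mathbb{F}_{q^n}$ (the companion automorphism). For a $q$-polynomial $f$, put $k_f(x)=ax^\sigma+bf(x)^\sigma$ and $h_f(x)=cx^\sigma+df(x)^\sigma$; if $k_f$ is a bijection of $\mathbb{F}_{q^n}$, then $f_\varphi$ denotes the $q$-polynomial $h_f\circ k_f^{-1}$, i.e. the unique function whose graph $\{(y,f_\varphi(y))\}$ is the image under $\varphi$ of the graph $\{(x,f(x)) : x\in\mathbb{F}_{q^n}\}$. *)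

theory Defs
  imports
    "HOL-Analysis.Cartesian_Space"
    "HOL-Computational_Algebra.Polynomial"
    "HOL-Number_Theory.Prime_Powers"
begin

text \<open>
  Throughout, the field with \<open>q ^ n\<close> elements is a type \<open>'a :: {field, finite}\<close> with
  \<open>CARD('a) = q ^ n\<close>.
\<close>

definition q_polynomial :: "nat \<Rightarrow> nat \<Rightarrow> 'a::comm_semiring_1 poly \<Rightarrow> bool" where
  "q_polynomial q n f \<longleftrightarrow> (\<exists>a :: nat \<Rightarrow> 'a. f = (\<Sum>i<n. monom (a i) (q ^ i)))"

text \<open>
  The coefficient \<open>a\<^sub>i\<close> of a \<open>q\<close>-polynomial is \<open>coeff f (q ^ i)\<close>; reducing the Frobenius
  exponent \<open>n - i\<close> modulo \<open>n\<close> only affects \<open>i = 0\<close>, where \<open>q ^ n\<close> is read as \<open>q ^ 0\<close>.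
\<close>

definition adjoint_poly :: "nat \<Rightarrow> nat \<Rightarrow> 'a::comm_semiring_1 poly \<Rightarrow> 'a poly" where
  "adjoint_poly q n f =
     (\<Sum>i<n. monom (coeff f (q ^ i) ^ (q ^ ((n - i) mod n))) (q ^ ((n - i) mod n)))"

definition im_ratio :: "'a::field poly \<Rightarrow> 'a set" where
  "im_ratio f = {poly f x / x | x. x \<noteq> 0}"

definition field_norm :: "nat \<Rightarrow> nat \<Rightarrow> 'a::comm_semiring_1 \<Rightarrow> 'a" where
  "field_norm q n x = x ^ (\<Sum>i<n. q ^ i)"

text \<open>
  For \<open>m\<close> dividing \<open>n\<close>, the unique subfield with \<open>q ^ m\<close> elements of a field with \<open>q ^ n\<close>
  elements consists of the roots of \<open>X ^ (q ^ m) - X\<close>.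
\<close>

definition subfield_of_degree :: "nat \<Rightarrow> nat \<Rightarrow> 'a::comm_semiring_1 set" where
  "subfield_of_degree q m = {x. x ^ (q ^ m) = x}"

definition linear_over :: "'a::comm_semiring_1 set \<Rightarrow> 'a poly \<Rightarrow> bool" where
  "linear_over K f \<longleftrightarrow> (\<forall>\<mu>\<in>K. \<forall>x. poly f (\<mu> * x) = \<mu> * poly f x)"

definition max_field_of_linearity :: "nat \<Rightarrow> nat \<Rightarrow> 'a::comm_semiring_1 poly \<Rightarrow> 'a set" where
  "max_field_of_linearity q n f =
     subfield_of_degree q (GREATEST m. m dvd n \<and> linear_over (subfield_of_degree q m) f)"

definition field_automorphism :: "('a::field \<Rightarrow> 'a) \<Rightarrow> bool" where
  "field_automorphism \<sigma> \<longleftrightarrow>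
     bij \<sigma> \<and> \<sigma> 1 = 1 \<and> (\<forall>x y. \<sigma> (x + y) = \<sigma> x + \<sigma> y) \<and> (\<forall>x y. \<sigma> (x * y) = \<sigma> x * \<sigma> y)"

definition GammaL2 :: "('a::field ^ 2 \<Rightarrow> 'a ^ 2) set" where
  "GammaL2 = {\<phi>. \<exists>(A :: 'a ^ 2 ^ 2) \<sigma>. invertible A \<and> field_automorphism \<sigma> \<and>
                 \<phi> = (\<lambda>v. A *v (\<chi> i. \<sigma> (v $ i)))}"

definition k_map :: "('a::zero ^ 2 \<Rightarrow> 'a ^ 2) \<Rightarrow> ('a \<Rightarrow> 'a) \<Rightarrow> 'a \<Rightarrow> 'a" where
  "k_map \<phi> f x = \<phi> (vector [x, f x]) $ 1"

definition h_map :: "('a::zero ^ 2 \<Rightarrow> 'a ^ 2) \<Rightarrow> ('a \<Rightarrow> 'a) \<Rightarrow> 'a \<Rightarrow> 'a" where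
  "h_map \<phi> f x = \<phi> (vector [x, f x]) $ 2"

text \<open>The function \<open>f\<^sub>\<phi>\<close>; meaningful only if \<open>k_map \<phi> f\<close> is a bijection.\<close>

definition transformed :: "('a::zero ^ 2 \<Rightarrow> 'a ^ 2) \<Rightarrow> ('a \<Rightarrow> 'a) \<Rightarrow> 'a \<Rightarrow> 'a" where
  "transformed \<phi> f = h_map \<phi> f \<circ> inv (k_map \<phi> f)"

lemma semilinear_coordinates:
  fixes A :: "'a::field ^ 2 ^ 2"
  assumes "\<phi> = (\<lambda>v. A *v (\<chi> i. \<sigma> (v $ i)))"
  shows "k_map \<phi> f x = A $ 1 $ 1 * \<sigma> x + A $ 1 $ 2 * \<sigma> (f x)"
    and "h_map \<phi> f x = A $ 2 $ 1 * \<sigma> x + A $ 2 $ 2 * \<sigma> (f x)"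
  by (simp_all add: assms k_map_def h_map_def matrix_vector_mult_def sum_2)

lemma graph_transformed:
  fixes \<phi> :: "'a::zero ^ 2 \<Rightarrow> 'a ^ 2"
  assumes "bij (k_map \<phi> f)"
  shows "range (\<lambda>y. vector [y, transformed \<phi> f y]) = \<phi> ` range (\<lambda>x. vector [x, f x])"
proof -
  have *: "vector [k_map \<phi> f x, transformed \<phi> f (k_map \<phi> f x)] = \<phi> (vector [x, f x])" for x
  proof -
    have "transformed \<phi> f (k_map \<phi> f x) = h_map \<phi> f x"
      using assms by (simp add: transformed_def bij_is_inj)
    then show ?thesis
      by (simp add: vec_eq_iff forall_2 k_map_def h_map_def)
  qed
  have "range (\<lambda>y. vector [y, transformed \<phi> f y] :: 'a ^ 2)
          = (\<lambda>y. vector [y, transformed \<phi> f y]) ` range (k_map \<phi> f)"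
    using assms by (simp add: bij_is_surj)
  then show ?thesis
    by (simp add: image_image *)
qed

end

theory Submission
  imports Defs
    "HOL-Analysis.Determinants"
    "HOL-Combinatorics.Permutations"
    "HOL-Number_Theory.Cong"
begin

text \<open>
  Each fibre of \<open>x \<mapsto> f x / x\<close> on the nonzero elements has cardinality \<open>- 1\<close> in the field, so equal image
  sets have equal power sums. Summing \<open>\<Prod>i\<in>S. (f x / x) ^ (q ^ i)\<close> over \<open>x\<close> yields, up to sign, the
  principal permanent on \<open>S\<close> of the matrix with entries \<open>a\<^bsub>j - i\<^esub> ^ (q ^ i)\<close>, indices modulo 5. Hence
  the matrices of \<open>f\<close> and \<open>g\<close> have the same principal permanents, and after subtracting the common
  coefficient of \<open>x\<close> their diagonals vanish. The \<open>2\<close>-subsets and \<open>3\<close>-subsets then determine the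
  products along each 3-cycle of indices up to reversal. If all 3-cycles are preserved, \<open>g\<close> is
  \<open>f (\<mu> x) / \<mu>\<close> by Hilbert 90; if all are reversed, the same holds for the adjoint. If the two orbits
  of 3-cycles behave differently, the \<open>4\<close>-subsets and the whole index set force
  \<open>\<nu> f = \<tau> + \<tau>\<^sup>2 + \<tau>\<^sup>3 + \<tau>\<^sup>4\<close> for a monomial semilinear map \<open>\<tau>\<close> whose fifth power is a scalar \<open>t \<noteq> 1\<close>,
  and likewise for \<open>g\<close> with the same \<open>\<nu>\<close> and \<open>t\<close>. Then \<open>t x + \<nu> f x = \<tau> (x + \<nu> f x)\<close>, which
  is the required monomial form.
\<close>

subsection \<open>Permanents\<close>

definition permanent :: "'i set \<Rightarrow> ('i \<Rightarrow> 'i \<Rightarrow> 'b::comm_semiring_1) \<Rightarrow> 'b" where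
  "permanent S X = (\<Sum>p | p permutes S. \<Prod>i\<in>S. X i (p i))"

lemma permanent_cong:
  assumes "\<And>i j. i \<in> S \<Longrightarrow> j \<in> S \<Longrightarrow> X i j = Y i j"
  shows "permanent S X = permanent S Y"
  unfolding permanent_def using assms by (intro sum.cong prod.cong) (auto simp: permutes_in_image)

lemma permanent_transpose:
  assumes "finite S"
  shows "permanent S (\<lambda>i j. X j i) = permanent S X"
proof -
  have "permanent S (\<lambda>i j. X j i) = (\<Sum>p | p permutes S. \<Prod>i\<in>S. X (inv p i) i)"
    unfolding permanent_def by (rule sum_permutations_inverse)
  also have "\<dots> = permanent S X"
    unfolding permanent_def
  proof (intro sum.cong refl)
    fix p assume "p \<in> {p. p permutes S}"
    then have p: "p permutes S" by simp
    show "(\<Prod>i\<in>S. X (inv p i) i) = (\<Prod>i\<in>S. X i (p i))"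
      using prod.permute[OF p, of "\<lambda>i. X (inv p i) i"] permutes_inverses(2)[OF p] by (simp add: o_def)
  qed
  finally show ?thesis .
qed

lemma permanent_scale_rows:
  "permanent S (\<lambda>i j. c i * X i j) = (\<Prod>i\<in>S. c i) * permanent S X"
  by (simp add: permanent_def prod.distrib sum_distrib_left)

text \<open>Along a permutation of \<open>S\<close> the factors \<open>c j\<close> and
  \<open>1 / c i\<close> cancel, so conjugation by a diagonal matrix preserves principal
  permanents.\<close>

lemma permanent_conj:
  fixes X :: "'i \<Rightarrow> 'i \<Rightarrow> 'b::field"
  assumes "finite S" and "\<And>i. i \<in> S \<Longrightarrow> c i \<noteq> 0"
  shows "permanent S (\<lambda>i j. X i j * c j / c i) = permanent S X"
  unfolding permanent_def
proof (intro sum.cong refl)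
  fix p assume "p \<in> {p. p permutes S}"
  then have "(\<Prod>i\<in>S. c (p i)) = (\<Prod>i\<in>S. c i)"
    using prod.permute[of p S c] by (simp add: o_def)
  then show "(\<Prod>i\<in>S. X i (p i) * c (p i) / c i) = (\<Prod>i\<in>S. X i (p i))"
    using assms by (simp add: prod.distrib prod_dividef)
qed

lemma permanent_image:
  assumes h: "bij_betw h S T"
  shows "permanent T X = permanent S (\<lambda>i j. X (h i) (h j))"
proof -
  define F where "F = (\<lambda>p x. if x \<in> T then h (p (inv_into S h x)) else x)"
  have "bij_betw F {p. p permutes S} {p. p permutes T}"
    unfolding F_def by (rule bij_betw_permutations[OF h])
  then have "permanent T X = (\<Sum>p | p permutes S. \<Prod>i\<in>T. X i (F p i))"
    unfolding permanent_def by (rule sum.reindex_bij_betw[symmetric])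
  also have "\<dots> = permanent S (\<lambda>i j. X (h i) (h j))"
    unfolding permanent_def
  proof (intro sum.cong refl)
    fix p
    have "(\<Prod>i\<in>T. X i (F p i)) = (\<Prod>i\<in>S. X (h i) (F p (h i)))"
      by (rule prod.reindex_bij_betw[OF h, symmetric])
    also have "\<dots> = (\<Prod>i\<in>S. X (h i) (h (p i)))"
      using h by (intro prod.cong) (auto simp: F_def bij_betw_def)
    finally show "(\<Prod>i\<in>T. X i (F p i)) = (\<Prod>i\<in>S. X (h i) (h (p i)))" .
  qed
  finally show ?thesis .
qed

section \<open>Expansion of permanents along rows\<close>

fun laplace :: "('i \<Rightarrow> 'i \<Rightarrow> 'b::comm_semiring_1) \<Rightarrow> 'i list \<Rightarrow> 'i list \<Rightarrow> 'b" where
  "laplace X [] cs = 1"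
| "laplace X (i # is) cs = (\<Sum>j\<leftarrow>cs. X i j * laplace X is (remove1 j cs))"

text \<open>An injection on \<open>i # is\<close> is a column for row \<open>i\<close> together with
  an injection of the other rows into the remaining columns; this is the recursion of
  \<open>laplace\<close>.\<close>

lemma sum_injective_laplace:
  assumes "distinct is" and "distinct cs"
  shows "(\<Sum>t | t \<in> set is \<rightarrow>\<^sub>E set cs \<and> inj_on t (set is). \<Prod>i\<in>set is. X i (t i)) = laplace X is cs"
  using assms
proof (induction "is" arbitrary: cs)
  case Nil
  show ?case by simp
next
  case (Cons i "is")
  let ?S = "set is" and ?T = "set cs"
  let ?P = "{(y, g). y \<in> ?T \<and> g \<in> ?S \<rightarrow>\<^sub>E (?T - {y}) \<and> inj_on g ?S}"
  let ?h = "\<lambda>t. \<Prod>i\<in>set (i # is). X i (t i)"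
  have i: "i \<notin> ?S" using Cons.prems by simp
  have "(\<Sum>t | t \<in> set (i # is) \<rightarrow>\<^sub>E ?T \<and> inj_on t (set (i # is)). ?h t) = (\<Sum>t\<in>(\<lambda>(y, g). g(i := y)) ` ?P. ?h t)"
    using extensional_funcset_extend_domain_inj_on_eq[OF i, of ?T] by simp
  also have "\<dots> = (\<Sum>(y, g)\<in>?P. ?h (g(i := y)))"
    by (subst sum.reindex[OF extensional_funcset_extend_domain_inj_onI[OF i]])
       (simp add: o_def case_prod_beta)
  also have "\<dots> = (\<Sum>(y, g)\<in>(SIGMA y:?T. {g. g \<in> ?S \<rightarrow>\<^sub>E (?T - {y}) \<and> inj_on g ?S}).
                     X i y * (\<Prod>i\<in>?S. X i (g i)))"
  proof (rule sum.cong)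
    fix z assume "z \<in> (SIGMA y:?T. {g. g \<in> ?S \<rightarrow>\<^sub>E (?T - {y}) \<and> inj_on g ?S})"
    have "(\<Prod>j\<in>?S. X j (if j = i then y else g j)) = (\<Prod>i\<in>?S. X i (g i))" for y g
      using i by (intro prod.cong) auto
    then show "(case z of (y, g) \<Rightarrow> ?h (g(i := y))) = (case z of (y, g) \<Rightarrow> X i y * (\<Prod>i\<in>?S. X i (g i)))"
      using i by (auto simp: fun_upd_def)
  qed auto
  also have "\<dots> = (\<Sum>y\<in>?T. X i y * (\<Sum>g | g \<in> ?S \<rightarrow>\<^sub>E (?T - {y}) \<and> inj_on g ?S. \<Prod>i\<in>?S. X i (g i)))"
    by (subst sum.Sigma[symmetric])
       (auto simp: sum_distrib_left intro: finite_subset[OF _ finite_PiE[of ?S "\<lambda>_. ?T"]])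
  also have "\<dots> = (\<Sum>y\<in>?T. X i y * laplace X is (remove1 y cs))"
    using Cons.prems Cons.IH[of "remove1 _ cs"] by (intro sum.cong) simp_all
  also have "\<dots> = laplace X (i # is) cs"
    using Cons.prems by (simp add: sum_list_distinct_conv_sum_set)
  finally show ?case .
qed

text \<open>An injective self-map of a finite set, extended by the identity, is a permutation. This
  form fits both the row expansion and the expansion of a product of sums.\<close>

lemma permanent_eq_sum_injective:
  assumes "finite S"
  shows "permanent S X = (\<Sum>t | t \<in> S \<rightarrow>\<^sub>E S \<and> inj_on t S. \<Prod>i\<in>S. X i (t i))"
  unfolding permanent_def
proof (rule sum.reindex_bij_witness[where i = "\<lambda>t x. if x \<in> S then t x else x" and j = "\<lambda>p. restrict p S"])
  fix p assume "p \<in> {p. p permutes S}"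
  then have p: "p permutes S" by simp
  show "(\<lambda>x. if x \<in> S then restrict p S x else x) = p"
    using p by (auto simp: fun_eq_iff permutes_def)
  show "restrict p S \<in> {t. t \<in> S \<rightarrow>\<^sub>E S \<and> inj_on t S}"
    using p by (auto simp: permutes_in_image inj_on_def dest: permutes_inj injD)
  show "(\<Prod>i\<in>S. X i (restrict p S i)) = (\<Prod>i\<in>S. X i (p i))"
    by (intro prod.cong) auto
next
  fix t assume "t \<in> {t. t \<in> S \<rightarrow>\<^sub>E S \<and> inj_on t S}"
  then have t: "t \<in> S \<rightarrow>\<^sub>E S" "inj_on t S" by auto
  then have "bij_betw t S S"
    using endo_inj_surj[OF assms, of t] by (auto simp: bij_betw_def)
  then have "bij_betw (\<lambda>x. if x \<in> S then t x else x) S S"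
    by (simp cong: bij_betw_cong)
  then show "(\<lambda>x. if x \<in> S then t x else x) \<in> {p. p permutes S}"
    by (auto intro: bij_imp_permutes)
  show "restrict (\<lambda>x. if x \<in> S then t x else x) S = t"
    using t(1) by (auto simp: fun_eq_iff PiE_def extensional_def)
qed

text \<open>Turns a permanent over a concrete index set into a recursion that rewriting can
  unfold.\<close>

lemma permanent_laplace: "distinct is \<Longrightarrow> permanent (set is) X = laplace X is is"
  by (simp add: permanent_eq_sum_injective sum_injective_laplace)

lemma permanent_0:
  "permanent {0::nat} X = X 0 0"
  using permanent_laplace[of "[0::nat]" X] by simp

lemma permanent_01:
  "permanent {0, 1::nat} X = X 0 0 * X 1 1 + X 0 1 * X 1 0"
  using permanent_laplace[of "[0, 1::nat]" X] by simp

lemma permanent_02: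
  "permanent {0, 2::nat} X = X 0 0 * X 2 2 + X 0 2 * X 2 0"
  using permanent_laplace[of "[0, 2::nat]" X] by simp

lemma permanent_012:
  assumes "\<And>i. X i i = 0"
  shows "permanent {0, 1, 2::nat} X = X 0 1 * X 1 2 * X 2 0 + X 0 2 * X 1 0 * X 2 1"
  using permanent_laplace[of "[0, 1, 2::nat]" X] assms by (simp add: algebra_simps)

lemma permanent_024:
  assumes "\<And>i. X i i = 0"
  shows "permanent {0, 2, 4::nat} X = X 0 2 * X 2 4 * X 4 0 + X 0 4 * X 2 0 * X 4 2"
  using permanent_laplace[of "[0, 2, 4::nat]" X] assms by (simp add: algebra_simps)

text \<open>With zero diagonal only the nine derangements of four indices contribute: three double
  transpositions, then three 4-cycles, each next to its reversal.\<close>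

lemma permanent_0123:
  assumes "\<And>i. X i i = 0"
  shows "permanent {0, 1, 2, 3::nat} X =
      X 0 1 * X 1 0 * X 2 3 * X 3 2 + X 0 2 * X 2 0 * X 1 3 * X 3 1 + X 0 3 * X 3 0 * X 1 2 * X 2 1
    + X 0 1 * X 1 2 * X 2 3 * X 3 0 + X 0 3 * X 3 2 * X 2 1 * X 1 0
    + X 0 1 * X 1 3 * X 3 2 * X 2 0 + X 0 2 * X 2 3 * X 3 1 * X 1 0
    + X 0 2 * X 2 1 * X 1 3 * X 3 0 + X 0 3 * X 3 1 * X 1 2 * X 2 0"
  using permanent_laplace[of "[0, 1, 2, 3::nat]" X] assms
  by (simp add: algebra_simps)

text \<open>In the mixed case the matrix of coefficients has this shape up to conjugation by a diagonal matrix,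
  where \<open>m\<close> is the norm of the coefficient of \<open>s\<close> and \<open>k = 1 / m\<close>; the entries wrapping around
  the index set modulo 5 carry the factors \<open>m\<close> and \<open>k\<close>.\<close>

definition twisted :: "'a::field \<Rightarrow> 'a \<Rightarrow> (nat \<Rightarrow> 'a) \<Rightarrow> (nat \<Rightarrow> 'a) \<Rightarrow> nat \<Rightarrow> nat \<Rightarrow> 'a" where
  "twisted m k p w i j =
     (if i = j then 0
      else if i < j then (if j - i \<le> 2 then 1 else if j - i = 3 then w i * k else p i * k)
      else if i - j = 1 then p i else if i - j = 2 then w i else m)"

text \<open>Each of the 44 derangements of five indices contributes one monomial; accordingly the
  coefficients on the right add up to 44.\<close>

lemma permanent_twisted_01234:
  assumes "m * k = 1"
  shows "permanent {0, 1, 2, 3, 4} (twisted m k (\<lambda>_. t) (\<lambda>_. t)) =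
    m^2 + m * (1 + 10 * t) + (t^5 + 10 * t^4) * k + t^5 * k^2 + 10 * t^2 + 10 * t^3"
proof -
  let ?X = "twisted m k (\<lambda>_. t) (\<lambda>_. t)"
  have E: "permanent {0, 1, 2, 3, 4} ?X = laplace ?X [0,1,2,3,4] [0,1,2,3,4]"
    using permanent_laplace[of "[0, 1, 2, 3, 4::nat]" ?X] by simp
  show ?thesis
    unfolding E using assms by (simp add: twisted_def) algebra
qed

lemma permanent_twisted_024: "permanent {0, 2, 4} (twisted m k p w) = m + p 0 * w 4 * w 2 * k"
  by (subst permanent_024) (simp_all add: twisted_def)

lemma permanent_twisted_0123:
  assumes "m * k = 1"
  shows "permanent {0, 1, 2, 3} (twisted m k p w) =
      p 1 * p 3 + w 2 * w 3 + w 0 * p 2 + w 2 * p 3 + w 3 * p 1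
      + m * (1 + p 2) + w 0 * (p 1 * p 2 * p 3 + w 2 * w 3) * k"
  using assms by (subst permanent_0123) (simp_all add: twisted_def, algebra)

subsection \<open>Linearized polynomials for an automorphism of order five\<close>

text \<open>The Dickson matrix: row \<open>i\<close> lists the coefficients of the
  \<open>i\<close>-th iterate of \<open>s\<close> applied to the linearized polynomial. Adding 5
  first keeps the subtraction on naturals from truncating when \<open>i < 5\<close>.\<close>

definition dickson :: "('a \<Rightarrow> 'a) \<Rightarrow> (nat \<Rightarrow> 'a) \<Rightarrow> nat \<Rightarrow> nat \<Rightarrow> 'a" where
  "dickson s a i j = (s ^^ i) (a ((j + 5 - i) mod 5))"

definition same_permanents :: "('a::field \<Rightarrow> 'a) \<Rightarrow> (nat \<Rightarrow> 'a) \<Rightarrow> (nat \<Rightarrow> 'a) \<Rightarrow> bool" where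
  "same_permanents s a b \<longleftrightarrow> (\<forall>S\<subseteq>{..<5}. permanent S (dickson s a) = permanent S (dickson s b))"

definition linearized :: "('a::field \<Rightarrow> 'a) \<Rightarrow> (nat \<Rightarrow> 'a) \<Rightarrow> 'a \<Rightarrow> 'a" where
  "linearized s a x = (\<Sum>k<5. a k * (s ^^ k) x)"

text \<open>Chosen so that the Dickson matrix is transposed; for the Frobenius map these are the
  coefficients of \<open>adjoint_poly\<close>.\<close>

definition adjoint_coeffs :: "('a \<Rightarrow> 'a) \<Rightarrow> (nat \<Rightarrow> 'a) \<Rightarrow> nat \<Rightarrow> 'a" where
  "adjoint_coeffs s a k = (s ^^ k) (a ((5 - k) mod 5))"

text \<open>Coefficient form of g(x) = f(l x) / l.\<close>

definition gauge_equiv :: "('a::field \<Rightarrow> 'a) \<Rightarrow> (nat \<Rightarrow> 'a) \<Rightarrow> (nat \<Rightarrow> 'a) \<Rightarrow> bool" where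
  "gauge_equiv s a b \<longleftrightarrow> (\<exists>l. l \<noteq> 0 \<and> (\<forall>k<5. b k = a k * (s ^^ k) l / l))"

definition orbit_norm :: "('a::field \<Rightarrow> 'a) \<Rightarrow> 'a \<Rightarrow> 'a" where
  "orbit_norm s x = x * s x * s (s x) * s (s (s x)) * s (s (s (s x)))"

text \<open>The linear map \<open>(x, y) \<mapsto> (x + n y, t x + n y)\<close> takes the graph of the polynomial to the graph of
  \<open>c s\<^sup>i\<close>.\<close>

definition monomial_via :: "('a::field \<Rightarrow> 'a) \<Rightarrow> 'a \<Rightarrow> 'a \<Rightarrow> (nat \<Rightarrow> 'a) \<Rightarrow> bool" where
  "monomial_via s n t a \<longleftrightarrow> (\<exists>c. \<exists>i\<in>{1,2,3,4::nat}. orbit_norm s c = t \<and>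
     (\<forall>x. t * x + n * linearized s a x = c * (s ^^ i) (x + n * linearized s a x)))"

text \<open>The same \<open>n\<close> and \<open>t\<close> serve both sequences because one map must
  treat both graphs; \<open>n \<noteq> 0\<close> and \<open>t \<noteq> 1\<close> make it
  invertible.\<close>

definition both_monomial :: "('a::field \<Rightarrow> 'a) \<Rightarrow> (nat \<Rightarrow> 'a) \<Rightarrow> (nat \<Rightarrow> 'a) \<Rightarrow> bool" where
  "both_monomial s a b \<longleftrightarrow>
     (\<exists>n t. n \<noteq> 0 \<and> t \<noteq> 0 \<and> t \<noteq> 1 \<and> monomial_via s n t a \<and> monomial_via s n t b)"

lemma all_less_5: "(\<forall>k<5. P k) \<longleftrightarrow> P 0 \<and> P 1 \<and> P 2 \<and> P 3 \<and> P (4::nat)"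
  by (auto simp: numeral_eq_Suc All_less_Suc)

lemma sum_less_5: "(\<Sum>k<5. h k) = h 0 + h 1 + h 2 + h 3 + h (4::nat)"
  by (simp add: eval_nat_numeral)

lemma funpow_numerals:
  "(s ^^ 1) x = s x" "(s ^^ 2) x = s (s x)" "(s ^^ 3) x = s (s (s x))" "(s ^^ 4) x = s (s (s (s x)))"
  by (simp_all add: eval_nat_numeral)

lemma sum_prod_eq_cases:
  fixes x y :: "'a::field"
  assumes "x + y = x' + y'" and "x * y = x' * y'"
  shows "x' = x \<and> y' = y \<or> x' = y \<and> y' = x"
proof -
  have "(x' - x) * (x' - y) = 0"
    using assms by algebra
  then show ?thesis
    using assms(1) by auto
qed

text \<open>Products of the entries along the index cycles \<open>0 \<rightarrow> 1 \<rightarrow> 2 \<rightarrow> 0\<close> and \<open>0 \<rightarrow> 2 \<rightarrow> 4 \<rightarrow> 0\<close>, and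
  along the reversed cycles.\<close>

definition cycle_112 :: "('a::field \<Rightarrow> 'a) \<Rightarrow> (nat \<Rightarrow> 'a) \<Rightarrow> 'a" where
  "cycle_112 s a = a 1 * s (a 1) * s (s (a 3))"

definition cycle_112r :: "('a::field \<Rightarrow> 'a) \<Rightarrow> (nat \<Rightarrow> 'a) \<Rightarrow> 'a" where
  "cycle_112r s a = a 2 * s (s (a 4)) * s (a 4)"

definition cycle_221 :: "('a::field \<Rightarrow> 'a) \<Rightarrow> (nat \<Rightarrow> 'a) \<Rightarrow> 'a" where
  "cycle_221 s a = a 2 * s (s (a 2)) * s (s (s (s (a 1))))"

definition cycle_221r :: "('a::field \<Rightarrow> 'a) \<Rightarrow> (nat \<Rightarrow> 'a) \<Rightarrow> 'a" where
  "cycle_221r s a = a 4 * s (s (s (s (a 3)))) * s (s (a 3))"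

lemmas cycle_defs = cycle_112_def cycle_112r_def cycle_221_def cycle_221r_def

text \<open>The algebraic part uses only these properties of the Frobenius map, so its results apply
  to the square of \<open>s\<close> as well.\<close>

locale cyclic5 =
  fixes s :: "'a::field \<Rightarrow> 'a"
  assumes s_add: "s (x + y) = s x + s y"
    and s_mult: "s (x * y) = s x * s y"
    and s_1: "s 1 = 1"
    and s5: "s (s (s (s (s x)))) = x"
    and hilbert90: "orbit_norm s r = 1 \<Longrightarrow> \<exists>l. l \<noteq> 0 \<and> s l = r * l"
begin

lemma s_0: "s 0 = 0"
  using s_add[of 0 0] by (metis add_cancel_right_right add_0)

lemma s_eq_iff: "s x = s y \<longleftrightarrow> x = y"
  by (metis s5)

lemma s_eq_0_iff: "s x = 0 \<longleftrightarrow> x = 0"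
  using s_eq_iff[of x 0] by (simp add: s_0)

lemma s_divide: "s (x / y) = s x / s y"
proof (cases "y = 0")
  case False
  then have "s (x / y) * s y = s x" by (simp flip: s_mult)
  then show ?thesis using False by (simp add: field_simps s_eq_0_iff)
qed (simp add: s_0)

lemmas s_simps = s_add s_mult s_1 s5 s_0 s_divide s_eq_0_iff s_eq_iff

lemma orbit_norm_mult: "orbit_norm s (x * y) = orbit_norm s x * orbit_norm s y"
  by (simp only: orbit_norm_def s_mult mult_ac)

lemma orbit_norm_divide: "orbit_norm s (x / y) = orbit_norm s x / orbit_norm s y"
  by (simp only: orbit_norm_def s_divide times_divide_times_eq)

lemma orbit_norm_s: "orbit_norm s (s x) = orbit_norm s x"
  by (simp only: orbit_norm_def s5 mult_ac)

lemma s_orbit_norm: "s (orbit_norm s x) = orbit_norm s x"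
  by (simp only: orbit_norm_def s_mult s5 mult_ac)

lemma orbit_norm_fixed: "s x = x \<Longrightarrow> orbit_norm s x = x * x * x * x * x"
  by (simp add: orbit_norm_def)

lemma s_pow_mult: "(s ^^ i) (x * y) = (s ^^ i) x * (s ^^ i) y"
  by (induction i) (simp_all add: s_mult)

lemma s_pow_divide: "(s ^^ i) (x / y) = (s ^^ i) x / (s ^^ i) y"
  by (induction i) (simp_all add: s_divide)

lemma s_pow_1: "(s ^^ i) 1 = 1"
  by (induction i) (simp_all add: s_1)

lemma s_pow_0: "(s ^^ i) 0 = 0"
  by (induction i) (simp_all add: s_0)

lemma s_pow_5: "(s ^^ 5) x = x"
  by (simp add: eval_nat_numeral s5)

lemma s_pow_mod_5: "(s ^^ (n mod 5)) x = (s ^^ n) x"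
proof -
  have "(s ^^ (5 * k)) x = x" for k
    by (induction k) (simp_all add: funpow_add s_pow_5)
  then have "(s ^^ (n mod 5 + 5 * (n div 5))) x = (s ^^ (n mod 5)) x"
    by (simp only: funpow_add o_apply)
  then show ?thesis by simp
qed

lemma s_pow_pow: "(s ^^ i) ((s ^^ j) x) = (s ^^ ((i + j) mod 5)) x"
  by (simp add: s_pow_mod_5 funpow_add)

text \<open>For \<open>w = s t / t\<close> the hypothesis gives \<open>w * s (s w) = 1\<close>.
  Hence \<open>w\<close> is fixed by the fourth iterate of \<open>s\<close>, so by \<open>s\<close>,
  and w^2 = 1. As a quotient of conjugates \<open>w\<close> has norm 1, so w^5 = 1 and
  \<open>w = 1\<close>.\<close>

lemma fixed_if_mult_square_shift_fixed:
  assumes "t \<noteq> 0" and "s (t * s (s t)) = t * s (s t)"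
  shows "s t = t"
proof -
  define w where "w = s t / t"
  have w0: "w \<noteq> 0" using assms(1) by (simp add: w_def s_simps)
  have ww: "w * s (s w) = 1"
    using assms by (simp add: w_def s_simps field_simps)
  then have "s (s (w * s (s w))) = 1" by (simp add: s_1)
  then have "s (s w) * s (s (s (s w))) = 1" by (simp add: s_mult)
  then have "s (s (s (s w))) = w"
    using ww w0 by (metis mult.commute mult.left_neutral mult.assoc)
  then have sw: "s w = w" using s5 by metis
  have "orbit_norm s w = 1"
    using assms(1) by (simp add: orbit_norm_def w_def s_simps)
  then have "w * w * w * w * w = 1" by (simp only: orbit_norm_def sw)
  moreover have "w * w = 1" using ww by (simp only: sw)
  ultimately have "w = 1" by simp
  then show ?thesis using assms(1) by (simp add: w_def)
qed

text \<open>The matrix of the adjoint is the transpose, which has the same principal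
  permanents.\<close>

lemma same_permanents_adjoint:
  assumes "same_permanents s a b"
  shows "same_permanents s a (adjoint_coeffs s b)"
  unfolding same_permanents_def
proof (intro allI impI)
  fix S :: "nat set" assume S: "S \<subseteq> {..<5}"
  have "permanent S (dickson s (adjoint_coeffs s b)) = permanent S (\<lambda>i j. dickson s b j i)"
  proof (rule permanent_cong)
    fix i j assume "i \<in> S" "j \<in> S"
    then have ij: "i < 5" "j < 5" using S by auto
    have "(i + (j + 5 - i) mod 5) mod 5 = j" using ij by (simp add: mod_add_right_eq)
    moreover have "(5 - (j + 5 - i) mod 5) mod 5 = (i + 5 - j) mod 5"
    proof (cases "i \<le> j")
      case True
      then have *: "j + 5 - i = (j - i) + 5" and **: "i + 5 - j = 5 - (j - i)" using ij by simp_all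
      have "(j + 5 - i) mod 5 = j - i" unfolding * using ij by simp
      then show ?thesis unfolding ** by (rule arg_cong)
    next
      case False
      then have "(j + 5 - i) mod 5 = j + 5 - i" "5 - (j + 5 - i) = i - j" "i + 5 - j = (i - j) + 5"
        using ij by simp_all
      then show ?thesis by (simp only: mod_add_self2)
    qed
    ultimately show "dickson s (adjoint_coeffs s b) i j = dickson s b j i"
      by (simp only: dickson_def adjoint_coeffs_def s_pow_pow)
  qed
  also have "\<dots> = permanent S (dickson s b)"
    using S by (intro permanent_transpose) (auto intro: finite_subset)
  finally show "permanent S (dickson s a) = permanent S (dickson s (adjoint_coeffs s b))"
    using assms S by (simp add: same_permanents_def)
qed

lemma same_permanents_scale:
  assumes "same_permanents s a b"
  shows "same_permanents s (\<lambda>k. c * a k) (\<lambda>k. c * b k)"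
proof -
  have "dickson s (\<lambda>k. c * a k) = (\<lambda>i j. (s ^^ i) c * dickson s a i j)" for a
    by (simp add: dickson_def fun_eq_iff s_pow_mult)
  then show ?thesis using assms
    by (simp add: same_permanents_def permanent_scale_rows)
qed

lemma adjoint_adjoint: "k < 5 \<Longrightarrow> adjoint_coeffs s (adjoint_coeffs s a) k = a k"
  by (rule all_less_5[THEN iffD2, rule_format, rotated])
     (simp_all add: adjoint_coeffs_def funpow_numerals s5)

text \<open>Taking adjoints replaces the factor \<open>l\<close> by \<open>1 / l\<close>.\<close>

lemma gauge_equiv_adjoint:
  assumes "gauge_equiv s a (adjoint_coeffs s b)"
  shows "gauge_equiv s (adjoint_coeffs s a) b"
proof -
  obtain l where l: "l \<noteq> 0" "\<forall>k<5. adjoint_coeffs s b k = a k * (s ^^ k) l / l"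
    using assms by (auto simp: gauge_equiv_def)
  have "b k = adjoint_coeffs s a k * (s ^^ k) (1 / l) / (1 / l)" if k: "k < 5" for k
  proof -
    let ?j = "(5 - k) mod 5"
    have "b k = (s ^^ k) (adjoint_coeffs s b ?j)"
      using adjoint_adjoint[OF k, of b] by (simp add: adjoint_coeffs_def[of s "adjoint_coeffs s b"])
    also have "\<dots> = (s ^^ k) (a ?j * (s ^^ ?j) l / l)"
      using l(2) by simp
    also have "\<dots> = adjoint_coeffs s a k * (s ^^ k) ((s ^^ ?j) l) / (s ^^ k) l"
      by (simp add: s_pow_mult s_pow_divide adjoint_coeffs_def)
    also have "(s ^^ k) ((s ^^ ?j) l) = (s ^^ ((k + ?j) mod 5)) l"
      by (rule s_pow_pow)
    also have "(k + ?j) mod 5 = 0" using k by (simp add: mod_add_right_eq)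
    finally show ?thesis using l(1) by (simp add: s_pow_divide s_pow_1)
  qed
  then show ?thesis
    unfolding gauge_equiv_def using l(1) by (intro exI[of _ "1 / l"]) simp
qed


declare One_nat_def [simp del] One_nat_def [symmetric, simp]

lemma dickson_0: "a 0 = 0 \<Longrightarrow> dickson s a i i = 0"
  by (simp add: dickson_def s_pow_0)

lemma same_permanentsD: "same_permanents s a b \<Longrightarrow> S \<subseteq> {..<5} \<Longrightarrow> permanent S (dickson s a) = permanent S (dickson s b)"
  by (simp add: same_permanents_def)

section \<open>Invariants from principal permanents of size two and three\<close>

context
  fixes a b :: "nat \<Rightarrow> 'a"
  assumes same: "same_permanents s a b" and a0: "a 0 = 0" and b0: "b 0 = 0"
begin

lemma pair_14: "a 1 * s (a 4) = b 1 * s (b 4)"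
  using same_permanentsD[OF same, of "{0, 1}"] a0 b0
  by (simp add: permanent_01 dickson_0) (simp add: dickson_def funpow_numerals)

lemma pair_23: "a 2 * s (s (a 3)) = b 2 * s (s (b 3))"
  using same_permanentsD[OF same, of "{0, 2}"] a0 b0
  by (simp add: permanent_02 dickson_0) (simp add: dickson_def funpow_numerals)

lemma cycle_112_sum: "cycle_112 s a + cycle_112r s a = cycle_112 s b + cycle_112r s b"
  using same_permanentsD[OF same, of "{0, 1, 2}"] a0 b0
  by (simp add: permanent_012 dickson_0) (simp add: dickson_def funpow_numerals cycle_defs mult_ac)

lemma cycle_221_sum: "cycle_221 s a + cycle_221r s a = cycle_221 s b + cycle_221r s b"
  using same_permanentsD[OF same, of "{0, 2, 4}"] a0 b0
  by (simp add: permanent_024 dickson_0) (simp add: dickson_def funpow_numerals cycle_defs mult_ac)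

text \<open>The permanent on {0, 1, 2} gives the sum of the two products, and their product is built
  from the pair invariants. So both pairs are the roots of one quadratic.\<close>

lemma cycle_112_cases:
  "cycle_112 s b = cycle_112 s a \<and> cycle_112r s b = cycle_112r s a \<or>
   cycle_112 s b = cycle_112r s a \<and> cycle_112r s b = cycle_112 s a"
proof (rule sum_prod_eq_cases[OF cycle_112_sum])
  have "cycle_112 s c * cycle_112r s c = (c 1 * s (c 4)) * s (c 1 * s (c 4)) * (c 2 * s (s (c 3)))" for c
    by (simp add: cycle_defs s_simps mult_ac)
  then show "cycle_112 s a * cycle_112r s a = cycle_112 s b * cycle_112r s b"
    by (simp only: pair_14 pair_23)
qed

lemma cycle_221_cases:
  "cycle_221 s b = cycle_221 s a \<and> cycle_221r s b = cycle_221r s a \<or>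
   cycle_221 s b = cycle_221r s a \<and> cycle_221r s b = cycle_221 s a"
proof (rule sum_prod_eq_cases[OF cycle_221_sum])
  have "cycle_221 s c * cycle_221r s c =
      (c 2 * s (s (c 3))) * s (s (c 2 * s (s (c 3)))) * s (s (s (s (c 1 * s (c 4)))))" for c
    by (simp add: cycle_defs s_simps mult_ac)
  then show "cycle_221 s a * cycle_221r s a = cycle_221 s b * cycle_221r s b"
    by (simp only: pair_14 pair_23)
qed

end

text \<open>Hilbert 90 yields \<open>l\<close> with \<open>s l = r * l\<close>, so
  \<open>(s ^^ k) l / l\<close> is the product of the first \<open>k\<close> conjugates of
  \<open>r\<close>. For indices 3 and 4 the complementary conjugates stand on the side of
  \<open>b\<close>, which is equivalent because \<open>r\<close> has norm 1.\<close>

lemma gauge_equivI: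
  assumes "a 0 = 0" "b 0 = 0" and r: "orbit_norm s r = 1"
    and "b 1 = a 1 * r" "b 2 = a 2 * r * s r" "b 3 * s (s (s r)) * s (s (s (s r))) = a 3"
    and "b 4 * s (s (s (s r))) = a 4"
  shows "gauge_equiv s a b"
proof -
  obtain l where l: "l \<noteq> 0" "s l = r * l" using hilbert90[OF r] by blast
  have r0: "r \<noteq> 0" using r by (auto simp: orbit_norm_def)
  show ?thesis
    unfolding gauge_equiv_def all_less_5
  proof (intro exI conjI)
    show "b 3 = a 3 * (s ^^ 3) l / l"
    proof -
      have "a 3 * (s (s r) * s r * r) = b 3 * orbit_norm s r"
        by (simp add: orbit_norm_def mult_ac flip: assms(6))
      then show ?thesis using l r by (simp add: funpow_numerals s_mult mult_ac)
    qed
    show "b 4 = a 4 * (s ^^ 4) l / l"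
    proof -
      have "a 4 * (s (s (s r)) * s (s r) * s r * r) = b 4 * orbit_norm s r"
        by (simp add: orbit_norm_def mult_ac flip: assms(7))
      then show ?thesis using l r by (simp add: funpow_numerals s_mult mult_ac)
    qed
  qed (use l assms in \<open>simp_all add: funpow_numerals s_mult\<close>)
qed

text \<open>With \<open>r = b 1 / a 1\<close>, one pair invariant gives index 4, the first 3-cycle
  index 3, the other pair index 2, and the second 3-cycle shows that \<open>r\<close> has norm
  1.\<close>

lemma gauge_equiv_of_cycles:
  assumes same: "same_permanents s a b" and a0: "a 0 = 0" and b0: "b 0 = 0"
    and nz: "a 1 \<noteq> 0" "a 2 \<noteq> 0" "a 3 \<noteq> 0" "a 4 \<noteq> 0"
    and c1: "cycle_112 s b = cycle_112 s a" and c2: "cycle_221 s b = cycle_221 s a"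
  shows "gauge_equiv s a b"
proof -
  note p = pair_14[OF same a0 b0] pair_23[OF same a0 b0]
  have bnz: "b 1 \<noteq> 0" "b 4 \<noteq> 0" "b 2 \<noteq> 0" "b 3 \<noteq> 0"
    using p nz by (metis mult_eq_0_iff s_eq_0_iff)+
  define r where "r = b 1 / a 1"
  have r0: "r \<noteq> 0" using nz bnz by (simp add: r_def)
  have b1: "b 1 = a 1 * r" using nz by (simp add: r_def)
  have "s (b 4) * r = s (a 4)" using p(1) nz by (simp add: b1)
  then have "s (s (s (s (s (b 4) * r)))) = a 4" by (simp add: s5)
  then have b4: "b 4 * s (s (s (s r))) = a 4" by (simp add: s_simps)
  have b3': "s (s (b 3)) * r * s r = s (s (a 3))"
    using c1 nz by (simp add: cycle_defs b1 s_simps mult_ac)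
  then have "s (s (s (s (s (b 3)) * r * s r))) = a 3" by (simp add: s5)
  then have b3: "b 3 * s (s (s r)) * s (s (s (s r))) = a 3" by (simp add: s_simps)
  have b2: "b 2 = a 2 * r * s r"
  proof -
    have "b 2 * s (s (b 3)) = (a 2 * r * s r) * s (s (b 3))"
      by (simp only: p(2)[symmetric] b3'[symmetric] mult_ac)
    then show ?thesis using bnz by (simp add: s_simps)
  qed
  have "orbit_norm s r = 1"
    using c2 nz by (simp add: cycle_defs b1 b2 s_simps orbit_norm_def mult_ac)
  then show ?thesis using b1 b2 b3 b4 a0 b0 by (intro gauge_equivI)
qed


text \<open>The sequence is that of tau + tau^2 + tau^3 + tau^4 with tau^5 = t. If \<open>u\<close>
  has norm \<open>t\<close>, tau is \<open>u\<close> times \<open>s\<close>; if the norm is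
  \<open>t * t\<close>, the same sum arises from a multiple of the third iterate of
  \<open>s\<close>.\<close>

lemma monomial_viaI:
  assumes u: "u \<noteq> 0" and t: "t \<noteq> 0" "s t = t"
    and m: "orbit_norm s u = t \<or> orbit_norm s u = t * t"
    and c: "c 0 = 0" "c 1 = u" "c 2 = u * s u"
      "c 3 = t / (s (s (s u)) * s (s (s (s u))))" "c 4 = t / s (s (s (s u)))"
  shows "monomial_via s 1 t c"
proof -
  define u1 where "u1 = s u"
  define u2 where "u2 = s u1"
  define u3 where "u3 = s u2"
  define u4 where "u4 = s u3"
  have su: "s u = u1" "s u1 = u2" "s u2 = u3" "s u3 = u4" "s u4 = u"
    by (simp_all add: u1_def u2_def u3_def u4_def s5)
  have nz: "u1 \<noteq> 0" "u2 \<noteq> 0" "u3 \<noteq> 0" "u4 \<noteq> 0"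
    using u by (simp_all add: u1_def u2_def u3_def u4_def s_eq_0_iff)
  have L: "linearized s c x = u * s x + u * u1 * s (s x) + t / (u3 * u4) * s (s (s x)) + t / u4 * s (s (s (s x)))" for x
    by (simp add: linearized_def sum_less_5 c funpow_numerals su)
  show ?thesis
  proof (cases "orbit_norm s u = t")
    case True
    then have m: "t = u * u1 * u2 * u3 * u4" by (simp add: orbit_norm_def su)
    have "t * x + 1 * linearized s c x = u * (s ^^ 1) (x + 1 * linearized s c x)" for x
    proof -
      have "t / (u3 * u4) = u * u1 * u2" and "t / u4 = u * u1 * u2 * u3"
        using nz by (simp_all add: m)
      then have L': "linearized s c x = u * s x + u * u1 * s (s x) + u * u1 * u2 * s (s (s x))
          + u * u1 * u2 * u3 * s (s (s (s x)))" for x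
        by (simp add: L)
      show ?thesis
        unfolding L' funpow_numerals s_simps su mult_1 m by (simp add: algebra_simps)
    qed
    then show ?thesis
      unfolding monomial_via_def using True by blast
  next
    case False
    then have m0: "orbit_norm s u = t * t" using m by simp
    then have "t * t = u * u1 * u2 * u3 * u4" by (simp add: orbit_norm_def su)
    then have m: "u * u1 * u2 = t * t / (u3 * u4)" using nz by (simp add: field_simps)
    \<comment> \<open>Now tau is \<open>d\<close> times the third iterate of \<open>s\<close>, so
      \<open>d\<close> has to be the coefficient \<open>c 3\<close>.\<close>
    define d where "d = u * u1 * u2 / t"
    have d: "d = t / (u3 * u4)" using m t by (simp add: d_def)
    have "orbit_norm s d = t"
    proof -
      have "orbit_norm s d = (t * t) * (t * t) * (t * t) / (t * t * t * t * t)"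
        by (simp only: d_def u1_def u2_def orbit_norm_mult orbit_norm_divide orbit_norm_s
              orbit_norm_fixed[OF t(2)] m0)
      then show ?thesis using t(1) by simp
    qed
    moreover have "t * x + 1 * linearized s c x = d * (s ^^ 3) (x + 1 * linearized s c x)" for x
    proof -
      have e1: "u = d * t / (u1 * u2)" using u nz t by (simp add: d_def)
      have e2: "u * u1 = d * t / u2" using u nz t by (simp add: d_def)
      have e4: "t / u4 = d * u3" using u nz t by (simp add: d field_simps)
      have e0: "t = d * (u3 * u4)" using u nz t by (simp add: d field_simps)
      have "linearized s c x = d * t / (u1 * u2) * s x + d * t / u2 * s (s x) + d * s (s (s x)) + d * u3 * s (s (s (s x)))"
        unfolding L by (simp flip: e1 e2 e4 d)
      moreover have "(s ^^ 3) (x + 1 * linearized s c x) =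
         s (s (s x)) + (u3 * s (s (s (s x))) + u3 * u4 * x + t / (u1 * u2) * s x + t / u2 * s (s x))"
        by (simp add: L s_simps su funpow_numerals t(2))
      ultimately show ?thesis
        using e0 by (simp add: algebra_simps)
    qed
    ultimately show ?thesis
      unfolding monomial_via_def by blast
  qed
qed

subsection \<open>The mixed case\<close>

text \<open>Conjugation by the partial products of the norm of \<open>u\<close> turns the entries
  one or two places above the diagonal into 1.\<close>

lemma permanent_normal_form:
  assumes u: "u \<noteq> 0"
    and c: "c 0 = 0" "c 1 = u" "c 2 = u * s u"
      "c 3 = w / (s (s (s u)) * s (s (s (s u))))" "c 4 = p / s (s (s (s u)))"
    and S: "S \<subseteq> {..<5}"
  shows "permanent S (dickson s c) =
    permanent S (twisted (orbit_norm s u) (1 / orbit_norm s u) (\<lambda>i. (s ^^ i) p) (\<lambda>i. (s ^^ i) w))"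
    (is "_ = permanent S ?X")
proof -
  define u1 where "u1 = s u"
  define u2 where "u2 = s u1"
  define u3 where "u3 = s u2"
  define u4 where "u4 = s u3"
  have su: "s u = u1" "s u1 = u2" "s u2 = u3" "s u3 = u4" "s u4 = u"
    by (simp_all add: u1_def u2_def u3_def u4_def s5)
  have nz: "u \<noteq> 0" "u1 \<noteq> 0" "u2 \<noteq> 0" "u3 \<noteq> 0" "u4 \<noteq> 0"
    using u by (simp_all add: u1_def u2_def u3_def u4_def s_eq_0_iff)
  define \<phi> where "\<phi> = (\<lambda>i. [1, u, u * u1, u * u1 * u2, u * u1 * u2 * u3] ! i)"
  have \<phi>: "\<phi> 0 = 1" "\<phi> 1 = u" "\<phi> 2 = u * u1" "\<phi> 3 = u * u1 * u2" "\<phi> 4 = u * u1 * u2 * u3"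
    by (simp_all add: \<phi>_def nth_Cons')
  have m: "orbit_norm s u = u * u1 * u2 * u3 * u4"
    by (simp add: orbit_norm_def su)
  have "\<forall>i<5. \<forall>j<5. dickson s c i j = ?X i j * \<phi> j / \<phi> i"
    unfolding all_less_5 dickson_def twisted_def m
    by (simp add: \<phi> c funpow_numerals s_simps su) (use nz in \<open>simp add: field_simps\<close>)
  then have "permanent S (dickson s c) = permanent S (\<lambda>i j. ?X i j * \<phi> j / \<phi> i)"
    using S by (intro permanent_cong) auto
  also have "\<dots> = permanent S ?X"
  proof (rule permanent_conj)
    show "finite S" using S by (rule finite_subset) simp
    have "\<forall>i<5. \<phi> i \<noteq> 0" unfolding all_less_5 using nz by (simp add: \<phi>)
    then show "\<phi> i \<noteq> 0" if "i \<in> S" for i using S that by auto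
  qed
  finally show ?thesis .
qed

text \<open>The two sequences share \<open>p\<close> and \<open>w\<close>, but \<open>u\<close> and
  \<open>v\<close> have different norms m and n. The permanents on {0, 2, 4}, {0, 1, 2, 3} and all
  indices are compared, dividing out m - n each time; the outcome is p = w = t and {m, n} = {t,
  t^2}.\<close>

lemma both_monomial_normal_form:
  assumes same: "same_permanents s a b"
    and nz: "u \<noteq> 0" "v \<noteq> 0" "p \<noteq> 0" "w \<noteq> 0"
    and a: "a 0 = 0" "a 1 = u" "a 2 = u * s u"
      "a 3 = w / (s (s (s u)) * s (s (s (s u))))" "a 4 = p / s (s (s (s u)))"
    and b: "b 0 = 0" "b 1 = v" "b 2 = v * s v"
      "b 3 = w / (s (s (s v)) * s (s (s (s v))))" "b 4 = p / s (s (s (s v)))"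
    and uv: "orbit_norm s u \<noteq> orbit_norm s v"
    and pw: "s p * s (s p) \<noteq> s (s w)"
  shows "\<exists>t. t \<noteq> 0 \<and> t \<noteq> 1 \<and> monomial_via s 1 t a \<and> monomial_via s 1 t b"
proof -
  define m where "m = orbit_norm s u"
  define n where "n = orbit_norm s v"
  have mn: "m \<noteq> 0" "n \<noteq> 0" "m \<noteq> n"
    using nz uv by (simp_all add: m_def n_def orbit_norm_def s_eq_0_iff)
  have eq: "permanent S (twisted m (1 / m) (\<lambda>i. (s ^^ i) p) (\<lambda>i. (s ^^ i) w)) =
      permanent S (twisted n (1 / n) (\<lambda>i. (s ^^ i) p) (\<lambda>i. (s ^^ i) w))" if "S \<subseteq> {..<5}" for S
    using same_permanentsD[OF same that]
      permanent_normal_form[OF nz(1) a that] permanent_normal_form[OF nz(2) b that]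
    by (simp add: m_def n_def)
  have "m + p * s (s (s (s w))) * s (s w) / m = n + p * s (s (s (s w))) * s (s w) / n"
    using eq[of "{0, 2, 4}"] by (simp add: permanent_twisted_024 funpow_numerals)
  then have "(m - n) * (m * n - p * s (s (s (s w))) * s (s w)) = 0"
    using mn(1,2) by (simp add: field_simps)
  then have K: "p * s (s (s (s w))) * s (s w) = m * n"
    using mn(3) by simp
  have smn: "s (m * n) = m * n"
    by (simp add: s_mult m_def n_def s_orbit_norm)
  \<comment> \<open>In the desired form \<open>p\<close> and \<open>w\<close> equal a fixed
    \<open>t\<close>, which suggests this quotient. It is the ratio of \<open>cycle_112r\<close> to
    \<open>cycle_112\<close>.\<close>
  define t where "t = s p * s (s p) / s (s w)"
  have t0: "t \<noteq> 0" using nz by (simp add: t_def s_eq_0_iff)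
  have "t * s (s t) = orbit_norm s p / (p * s (s (s (s w))) * s (s w))"
    using nz by (simp add: t_def orbit_norm_def s_simps field_simps)
  then have "t * s (s t) = orbit_norm s p / (m * n)" by (simp only: K)
  then have "s (t * s (s t)) = t * s (s t)"
    by (simp only: s_divide s_orbit_norm smn)
  then have st: "s t = t" by (rule fixed_if_mult_square_shift_fixed[OF t0])
  have t1: "t \<noteq> 1" using pw nz by (auto simp: t_def s_eq_0_iff)
  define p1 where "p1 = s p"
  define p2 where "p2 = s p1"
  define p3 where "p3 = s p2"
  have sp: "s p = p1" "s p1 = p2" "s p2 = p3" by (simp_all add: p1_def p2_def p3_def)
  have p0: "p1 \<noteq> 0" "p2 \<noteq> 0" "p3 \<noteq> 0"
    using nz by (simp_all add: p1_def p2_def p3_def s_eq_0_iff)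
  have w2: "s (s w) = p1 * p2 / t"
    using nz t0 by (simp add: t_def s_simps sp field_simps)
  have "s (s (s w)) = s (p1 * p2 / t)" by (simp only: w2)
  then have w3: "s (s (s w)) = p2 * p3 / t" by (simp only: s_mult s_divide st sp)
  have "s (s (s (p * s (s (s (s w))) * s (s w)))) = s (s (s (m * n)))" by (simp only: K)
  then have K3: "p3 * s (s w) * w = m * n"
    by (simp only: smn) (simp only: s_mult s5 sp)
  have "p1 * p3 + s (s w) * s (s (s w)) + w * p2 + s (s w) * p3 + s (s (s w)) * p1
      + m * (1 + p2) + w * (p1 * p2 * p3 + s (s w) * s (s (s w))) * (1 / m) =
     p1 * p3 + s (s w) * s (s (s w)) + w * p2 + s (s w) * p3 + s (s (s w)) * p1
      + n * (1 + p2) + w * (p1 * p2 * p3 + s (s w) * s (s (s w))) * (1 / n)"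
    using eq[of "{0, 1, 2, 3}"] mn(1,2)
    by (simp add: permanent_twisted_0123 funpow_numerals sp)
  then have "(m - n) * (m * n * (1 + p2) - w * (p1 * p2 * p3 + s (s w) * s (s (s w)))) = 0"
    using mn(1,2) by (simp add: field_simps)
  then have "m * n * (1 + p2) = w * (p1 * p2 * p3 + s (s w) * s (s (s w)))"
    using mn(3) by simp
  then have "w * (p3 * s (s w) * (1 + p2)) = w * (p1 * p2 * p3 + s (s w) * s (s (s w)))"
    by (simp only: K3[symmetric] mult_ac)
  then have "p3 * s (s w) * (1 + p2) = p1 * p2 * p3 + s (s w) * s (s (s w))"
    using nz by simp
  then have "p3 * s (s w) * (1 + p2) = p1 * p2 * p3 + s (s w) * (p2 * p3 / t)"
    by (simp only: w3)
  then have "t * (p1 * p2 * p3 * ((t - 1) * (t - p2))) = 0"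
    unfolding w2 using t0 by (simp add: field_simps)
  \<comment> \<open>The permanents on {0, 1, 2, 3} have been reduced, up to nonzero factors, to
    \<open>(t - 1) * (t - p2) = 0\<close>.\<close>
  then have "p2 = t" using p0 t0 t1 by simp
  then have "p3 = t" "s (s (s (s (s p)))) = s (s t)"
    using st by (simp_all add: sp p3_def)
  then have pt: "p = t" using st by (simp add: s5)
  have "s (s (s (s (s w)))) = t"
    using t0 st w2 by (simp add: sp(1)[symmetric] \<open>p2 = t\<close> pt)
  then have wt: "w = t" by (simp add: s5)
  have pow: "(s ^^ i) t = t" for i by (induction i) (simp_all add: st)
  have t3: "m * n = t * t * t" using K st by (simp add: pt wt)
  have k: "t * t * t * (1 / m) = n" "t * t * t * (1 / n) = m"
    using mn by (simp_all flip: t3)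
  have "m^2 + m * (1 + 10 * t) + (t^5 + 10 * t^4) * (1 / m) + t^5 * (1 / m)^2 + 10 * t^2 + 10 * t^3 =
        n^2 + n * (1 + 10 * t) + (t^5 + 10 * t^4) * (1 / n) + t^5 * (1 / n)^2 + 10 * t^2 + 10 * t^3"
    using eq[of "{0, 1, 2, 3, 4}"] mn(1,2)
    by (simp add: pt wt pow permanent_twisted_01234)
  \<comment> \<open>After multiplication by \<open>t\<close>, every power of \<open>1 / m\<close> or
    \<open>1 / n\<close> can be absorbed by t^3 = m n, so no fractions remain.\<close>
  then have "t * m^2 + t * m * (1 + 10 * t) + t * ((t^5 + 10 * t^4) * (1 / m)) + t * (t^5 * (1 / m)^2) =
        t * n^2 + t * n * (1 + 10 * t) + t * ((t^5 + 10 * t^4) * (1 / n)) + t * (t^5 * (1 / n)^2)"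
    by algebra
  moreover have "t * (t^5 * x^2) = (t * t * t * x)^2"
    "(t^5 + 10 * t^4) * x = (t * t + 10 * t) * (t * t * t * x)" for x
    by algebra+
  ultimately have "t * m^2 + t * m * (1 + 10 * t) + t * ((t * t + 10 * t) * n) + n^2 =
        t * n^2 + t * n * (1 + 10 * t) + t * ((t * t + 10 * t) * m) + m^2"
    by (simp only: k)
  then have "(t - 1) * ((m - n) * (m + n - t - t * t)) = 0"
    by algebra
  then have "m + n - t - t * t = 0" using t1 mn by simp
  then have "(m - t) * (m - t * t) = 0" "n = t + t * t - m"
    using t3 by algebra+
  then have mt: "m = t \<and> n = t * t \<or> m = t * t \<and> n = t"
    by auto
  have "monomial_via s 1 t a"
    using nz t0 st mt a by (intro monomial_viaI[of u]) (auto simp: m_def pt wt)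
  moreover have "monomial_via s 1 t b"
    using nz t0 st mt b by (intro monomial_viaI[of v]) (auto simp: n_def pt wt)
  ultimately show ?thesis using t0 t1 by blast
qed

end

subsection \<open>Passing to the square of the automorphism\<close>

text \<open>Coefficients of the same map with respect to the automorphism \<open>s \<circ> s\<close>, which exchanges the two
  orbits of 3-cycles.\<close>

definition relabel :: "(nat \<Rightarrow> 'b) \<Rightarrow> nat \<Rightarrow> 'b" where
  "relabel a k = a (2 * k mod 5)"

definition single_coeff :: "('a::field \<Rightarrow> 'a) \<Rightarrow> 'a \<Rightarrow> (nat \<Rightarrow> 'a) \<Rightarrow> bool" where
  "single_coeff s t a \<longleftrightarrow>
     (\<exists>i\<in>{1,2,3,4::nat}. a i \<noteq> 0 \<and> orbit_norm s (a i) = t \<and> (\<forall>x. linearized s a x = a i * (s ^^ i) x))"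

lemma double_triple_mod_5:
  assumes "k < (5::nat)"
  shows "2 * (3 * k mod 5) mod 5 = k" and "3 * (2 * k mod 5) mod 5 = k"
proof -
  have "\<forall>k<5. 2 * (3 * k mod 5) mod 5 = (k::nat) \<and> 3 * (2 * k mod 5) mod 5 = k"
    unfolding all_less_5 by simp
  then show "2 * (3 * k mod 5) mod 5 = k" "3 * (2 * k mod 5) mod 5 = k"
    using assms by blast+
qed

context cyclic5
begin

lemma cyclic5_square: "cyclic5 (\<lambda>x. s (s x))"
proof
  fix r assume "orbit_norm (\<lambda>x. s (s x)) r = 1"
  then have r: "orbit_norm s r = 1"
    by (simp add: orbit_norm_def s5 mult_ac)
  \<comment> \<open>Chosen so that \<open>y * s y = r\<close>; then \<open>s l = y * l\<close>
    implies \<open>s (s l) = r * l\<close>.\<close>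
  define y where "y = 1 / (s r * s (s (s r)))"
  have "orbit_norm s y = 1"
    using r by (simp add: y_def orbit_norm_divide orbit_norm_mult orbit_norm_s) (simp add: orbit_norm_def s_1)
  then obtain l where l: "l \<noteq> 0" "s l = y * l" using hilbert90 by blast
  have r0: "r \<noteq> 0" using r by (auto simp: orbit_norm_def)
  have "r * (s r * s (s (s r)) * s (s r) * s (s (s (s r)))) = 1"
    using r by (simp add: orbit_norm_def mult_ac)
  then have "y * s y = r"
    using r0 by (simp add: y_def s_simps field_simps)
  moreover have "s (s l) = y * s y * l" using l(2) by (simp add: s_mult mult_ac)
  ultimately show "\<exists>l. l \<noteq> 0 \<and> s (s l) = r * l" using l(1) by auto
qed (simp_all add: s_simps)

lemma square_funpow: "((\<lambda>x. s (s x)) ^^ k) x = (s ^^ (2 * k mod 5)) x"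
proof -
  have "((\<lambda>x. s (s x)) ^^ k) x = (s ^^ (2 * k)) x"
    by (induction k) simp_all
  then show ?thesis by (simp only: s_pow_mod_5)
qed

lemma relabel_index: "k < 5 \<Longrightarrow> relabel a (3 * k mod 5) = a k"
  by (simp only: relabel_def double_triple_mod_5)

lemma bij_double: "bij_betw (\<lambda>i. 2 * i mod 5) {..<5} {..<5::nat}"
  by (rule bij_betwI[where g = "\<lambda>i. 3 * i mod 5"]) (simp_all only: double_triple_mod_5 lessThan_iff Pi_iff, simp_all)

text \<open>Iterates of the square of \<open>s\<close> are iterates of \<open>s\<close> with doubled
  exponent, so the matrix is only renumbered and principal permanents go to principal
  permanents.\<close>

lemma dickson_relabel:
  assumes "i < 5" "j < 5"
  shows "dickson (\<lambda>x. s (s x)) (relabel a) i j = dickson s a (2 * i mod 5) (2 * j mod 5)"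
proof -
  have "\<forall>i<5. \<forall>j<5. 2 * ((j + 5 - i) mod 5) mod 5 = (2 * j mod 5 + 5 - 2 * i mod 5) mod (5::nat)"
    unfolding all_less_5 by simp
  then show ?thesis using assms
    by (simp add: dickson_def square_funpow relabel_def)
qed

lemma same_permanents_relabel:
  assumes "same_permanents s a b"
  shows "same_permanents (\<lambda>x. s (s x)) (relabel a) (relabel b)"
  unfolding same_permanents_def
proof (intro allI impI)
  fix S :: "nat set" assume S: "S \<subseteq> {..<5}"
  let ?h = "\<lambda>i. 2 * i mod (5::nat)"
  have b: "bij_betw ?h S (?h ` S)"
    using bij_double S by (rule bij_betw_subset) simp
  have "permanent S (dickson (\<lambda>x. s (s x)) (relabel c)) = permanent (?h ` S) (dickson s c)" for c
    unfolding permanent_image[OF b] using S by (intro permanent_cong dickson_relabel) auto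
  then show "permanent S (dickson (\<lambda>x. s (s x)) (relabel a)) = permanent S (dickson (\<lambda>x. s (s x)) (relabel b))"
    using assms S by (simp add: same_permanents_def image_subset_iff)
qed

lemma gauge_equiv_of_relabel:
  assumes "gauge_equiv (\<lambda>x. s (s x)) (relabel a) (relabel b)"
  shows "gauge_equiv s a b"
proof -
  obtain l where l: "l \<noteq> 0"
    and *: "\<And>k. k < 5 \<Longrightarrow> relabel b k = relabel a k * (s ^^ (2 * k mod 5)) l / l"
    using assms by (auto simp: gauge_equiv_def square_funpow)
  have "b k = a k * (s ^^ k) l / l" if k: "k < 5" for k
  proof -
    have "2 * (3 * k mod 5) mod 5 = k"
      using k by (rule double_triple_mod_5)
    then show ?thesis
      using *[of "3 * k mod 5"] relabel_index[OF k, of a] relabel_index[OF k, of b] by simp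
  qed
  then show ?thesis using l by (auto simp: gauge_equiv_def)
qed

lemma gauge_equiv_cong:
  assumes "\<And>k. k < 5 \<Longrightarrow> a k = a' k" "\<And>k. k < 5 \<Longrightarrow> b k = b' k"
  shows "gauge_equiv s a b \<longleftrightarrow> gauge_equiv s a' b'"
  using assms by (simp add: gauge_equiv_def)

lemma adjoint_relabel:
  assumes "k < 5"
  shows "adjoint_coeffs (\<lambda>x. s (s x)) (relabel b) k = relabel (adjoint_coeffs s b) k"
proof -
  have "\<forall>k<5. 2 * ((5 - k) mod 5) mod 5 = (5 - 2 * k mod 5) mod (5::nat)"
    unfolding all_less_5 by simp
  then show ?thesis using assms
    by (simp add: adjoint_coeffs_def square_funpow relabel_def)
qed

lemma linearized_relabel: "linearized (\<lambda>x. s (s x)) (relabel a) x = linearized s a x"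
  unfolding linearized_def square_funpow relabel_def
  by (rule sum.reindex_bij_betw[OF bij_double, of "\<lambda>k. a k * (s ^^ k) x"])

lemma orbit_norm_square: "orbit_norm (\<lambda>x. s (s x)) x = orbit_norm s x"
  by (simp only: orbit_norm_def s5 mult_ac)

lemma monomial_via_relabel:
  assumes "monomial_via (\<lambda>x. s (s x)) n t (relabel a)"
  shows "monomial_via s n t a"
proof -
  obtain c i where i: "i \<in> {1,2,3,4::nat}" and c: "orbit_norm s c = t"
    "\<forall>x. t * x + n * linearized s a x = c * (s ^^ (2 * i mod 5)) (x + n * linearized s a x)"
    using assms unfolding monomial_via_def linearized_relabel square_funpow orbit_norm_square by blast
  have "2 * i mod 5 \<in> {1,2,3,4}" using i by auto
  then show ?thesis using c unfolding monomial_via_def by blast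
qed

text \<open>The adjoint is put on \<open>b\<close> so that hypotheses on \<open>a\<close> serve both
  alternatives; \<open>gauge_equiv_adjoint\<close> moves it across.\<close>

definition gauge_or_adjoint :: "(nat \<Rightarrow> 'a) \<Rightarrow> (nat \<Rightarrow> 'a) \<Rightarrow> bool" where
  "gauge_or_adjoint a b \<longleftrightarrow> gauge_equiv s a b \<or> gauge_equiv s a (adjoint_coeffs s b)"

lemma gauge_or_adjoint_left:
  assumes "gauge_or_adjoint (adjoint_coeffs s a) b" shows "gauge_or_adjoint a b"
proof -
  have 1: "gauge_equiv s (adjoint_coeffs s (adjoint_coeffs s a)) c \<longleftrightarrow> gauge_equiv s a c" for c
    by (rule gauge_equiv_cong) (simp_all add: adjoint_adjoint)
  have 2: "gauge_equiv s (adjoint_coeffs s a) b \<longleftrightarrow>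
      gauge_equiv s (adjoint_coeffs s a) (adjoint_coeffs s (adjoint_coeffs s b))"
    by (rule gauge_equiv_cong) (simp_all add: adjoint_adjoint)
  show ?thesis
    using assms gauge_equiv_adjoint 1 2 unfolding gauge_or_adjoint_def by blast
qed

lemma gauge_or_adjoint_relabel:
  assumes "cyclic5.gauge_or_adjoint (\<lambda>x. s (s x)) (relabel a) (relabel b)"
  shows "gauge_or_adjoint a b"
proof -
  interpret sq: cyclic5 "\<lambda>x. s (s x)" by (rule cyclic5_square)
  have "gauge_equiv (\<lambda>x. s (s x)) (relabel a) (adjoint_coeffs (\<lambda>x. s (s x)) (relabel b)) \<longleftrightarrow>
      gauge_equiv (\<lambda>x. s (s x)) (relabel a) (relabel (adjoint_coeffs s b))"
    by (rule sq.gauge_equiv_cong) (simp_all add: adjoint_relabel)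
  then show ?thesis
    using assms gauge_equiv_of_relabel by (auto simp: gauge_or_adjoint_def sq.gauge_or_adjoint_def)
qed

lemma same_permanents_sym: "same_permanents s a b \<Longrightarrow> same_permanents s b a"
  by (simp add: same_permanents_def)

lemma same_permanents_adjoint_left:
  "same_permanents s a b \<Longrightarrow> same_permanents s (adjoint_coeffs s a) b"
  by (metis same_permanents_sym same_permanents_adjoint)

lemma adjoint_numerals:
  "adjoint_coeffs s a 0 = a 0" "adjoint_coeffs s a 1 = s (a 4)" "adjoint_coeffs s a 2 = s (s (a 3))"
  "adjoint_coeffs s a 3 = s (s (s (a 2)))" "adjoint_coeffs s a 4 = s (s (s (s (a 1))))"
  by (simp_all add: adjoint_coeffs_def funpow_numerals)

lemma relabel_numerals:
  "relabel a 0 = a 0" "relabel a 1 = a 2" "relabel a 2 = a 4" "relabel a 3 = a 1" "relabel a 4 = a 3"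
  by (simp_all add: relabel_def)

section \<open>Sequences whose coefficients 1 to 4 are all nonzero\<close>

lemma cycles_adjoint:
  "cycle_112 s (adjoint_coeffs s a) = cycle_112r s a" "cycle_112r s (adjoint_coeffs s a) = cycle_112 s a"
  "cycle_221 s (adjoint_coeffs s a) = cycle_221r s a" "cycle_221r s (adjoint_coeffs s a) = cycle_221 s a"
  by (simp_all add: cycle_defs adjoint_numerals s5 mult_ac)

lemma cycles_relabel:
  "cycle_112 (\<lambda>x. s (s x)) (relabel a) = cycle_221 s a"
  by (simp_all add: cycle_defs relabel_numerals)

text \<open>Scaling by \<open>n\<close> makes coefficient 2 equal to \<open>u * s u\<close>, as in
  the square of \<open>u\<close> times \<open>s\<close>. The equal 3-cycles carry this shape over to
  \<open>B\<close>. The two inequalities become the different norms of \<open>u\<close> and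
  \<open>v\<close> and the condition on \<open>p\<close> and \<open>w\<close> in
  \<open>both_monomial_normal_form\<close>.\<close>

lemma both_monomial_of_cycles:
  assumes same: "same_permanents s a b" and a0: "a 0 = 0" and b0: "b 0 = 0"
    and nz: "a 1 \<noteq> 0" "a 2 \<noteq> 0" "a 3 \<noteq> 0" "a 4 \<noteq> 0"
    and c1: "cycle_112 s b = cycle_112 s a" and c2: "cycle_221 s b \<noteq> cycle_221 s a"
    and c3: "cycle_112r s a \<noteq> cycle_112 s a"
  shows "both_monomial s a b"
proof -
  \<comment> \<open>The fourth iterate of \<open>s\<close> is its inverse, so this solves
    \<open>s n * a 1 * s (a 1) = a 2\<close>.\<close>
  define n where "n = s (s (s (s (a 2 / (a 1 * s (a 1))))))"
  have n0: "n \<noteq> 0" using nz by (simp add: n_def s_simps)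
  have sn: "s n * a 1 * s (a 1) = a 2" using nz by (simp add: n_def s_simps)
  define A where "A = (\<lambda>k. n * a k)"
  define B where "B = (\<lambda>k. n * b k)"
  have sameAB: "same_permanents s A B"
    unfolding A_def B_def by (rule same_permanents_scale[OF same])
  have A0: "A 0 = 0" and B0: "B 0 = 0" by (simp_all add: A_def B_def a0 b0)
  note p = pair_14[OF sameAB A0 B0] pair_23[OF sameAB A0 B0]
  have Anz: "A 1 \<noteq> 0" "A 2 \<noteq> 0" "A 3 \<noteq> 0" "A 4 \<noteq> 0" using nz n0 by (simp_all add: A_def)
  have Bnz: "B 1 \<noteq> 0" "B 4 \<noteq> 0" "B 2 \<noteq> 0" "B 3 \<noteq> 0"
    using p Anz by (metis mult_eq_0_iff s_eq_0_iff)+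
  have scale: "cycle_112 s (\<lambda>k. n * c k) = (n * s n * s (s n)) * cycle_112 s c"
    "cycle_112r s (\<lambda>k. n * c k) = (n * s n * s (s n)) * cycle_112r s c"
    "cycle_221 s (\<lambda>k. n * c k) = (n * s (s n) * s (s (s (s n)))) * cycle_221 s c" for c
    by (simp_all add: cycle_defs s_mult mult_ac)
  have C1: "cycle_112 s B = cycle_112 s A" using c1 by (simp add: A_def B_def scale)
  have C2: "cycle_221 s B \<noteq> cycle_221 s A" using c2 n0 by (simp add: A_def B_def scale s_simps)
  have C3: "cycle_112r s A \<noteq> cycle_112 s A" using c3 n0 by (simp add: A_def scale s_simps)
  define u where "u = A 1"
  define v where "v = B 1"
  define p where "p = A 4 * s (s (s (s u)))"
  define w where "w = A 3 * (s (s (s u)) * s (s (s (s u))))"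
  have nz': "u \<noteq> 0" "v \<noteq> 0" "p \<noteq> 0" "w \<noteq> 0"
    using Anz Bnz by (simp_all add: u_def v_def p_def w_def s_simps)
  have A4: "A 4 = p / s (s (s (s u)))" using nz' by (simp add: p_def s_simps)
  have A3: "A 3 = w / (s (s (s u)) * s (s (s (s u))))" using nz' by (simp add: w_def s_simps)
  have A2: "A 2 = u * s u" by (simp add: A_def u_def s_mult flip: sn)
  have "s (s (s (s (B 1 * s (B 4))))) = s (s (s (s (A 1 * s (A 4)))))" by (simp only: \<open>A 1 * s (A 4) = B 1 * s (B 4)\<close>)
  then have "B 4 * s (s (s (s v))) = p" by (simp add: s_simps p_def u_def v_def mult_ac)
  then have B4: "B 4 = p / s (s (s (s v)))" using nz' by (auto simp: s_simps field_simps)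
  have "s (s (s (cycle_112 s B))) = s (s (s (cycle_112 s A)))" by (simp only: C1)
  then have "B 3 * (s (s (s v)) * s (s (s (s v)))) = w"
    by (simp add: cycle_defs s_simps w_def u_def v_def mult_ac)
  then have B3: "B 3 = w / (s (s (s v)) * s (s (s (s v))))" using nz' by (auto simp: s_simps field_simps)
  have "B 2 * s (s (B 3)) = cycle_112 s A"
    using \<open>A 2 * s (s (A 3)) = B 2 * s (s (B 3))\<close> by (simp add: cycle_defs A2 u_def)
  also have "\<dots> = (v * s v) * s (s (B 3))" by (simp only: C1[symmetric]) (simp add: cycle_defs v_def)
  finally have B2: "B 2 = v * s v" using Bnz by (simp add: s_simps)
  have "orbit_norm s u \<noteq> orbit_norm s v"
    using C2 by (simp add: cycle_defs A2 B2 orbit_norm_def s_simps mult_ac flip: u_def v_def)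
  moreover have "s p * s (s p) \<noteq> s (s w)"
  proof -
    have "cycle_112r s A = s (s p) * s p" "cycle_112 s A = s (s w)"
      using nz' by (simp_all add: cycle_defs A2 A3 A4 s_simps flip: u_def)
    then show ?thesis using C3 by (simp add: mult.commute)
  qed
  ultimately obtain t where "t \<noteq> 0" "t \<noteq> 1" "monomial_via s 1 t A" "monomial_via s 1 t B"
    using both_monomial_normal_form[OF sameAB nz' A0 _ A2 A3 A4 B0 _ B2 B3 B4]
    by (auto simp: u_def v_def)
  moreover have "linearized s (\<lambda>k. n * c k) x = n * linearized s c x" for c x
    by (simp add: linearized_def sum_distrib_left mult_ac)
  ultimately show ?thesis
    unfolding both_monomial_def using n0 by (auto simp: monomial_via_def A_def B_def)
qed

text \<open>If the second orbit is reversed but the first 3-cycle product equals its own reversal,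
  the adjoint still fits both orbits. Only distinct products lead to the monomial case.\<close>

lemma nonzero_case_112:
  assumes same: "same_permanents s a b" and a0: "a 0 = 0" and b0: "b 0 = 0"
    and nz: "a 1 \<noteq> 0" "a 2 \<noteq> 0" "a 3 \<noteq> 0" "a 4 \<noteq> 0"
    and c1: "cycle_112 s b = cycle_112 s a"
  shows "gauge_or_adjoint a b \<or> both_monomial s a b"
proof (cases "cycle_221 s b = cycle_221 s a")
  case True
  then show ?thesis
    using gauge_equiv_of_cycles[OF same a0 b0 nz c1] by (simp add: gauge_or_adjoint_def)
next
  case False
  show ?thesis
  proof (cases "cycle_112r s a = cycle_112 s a")
    case True
    have "gauge_equiv s a (adjoint_coeffs s b)"
    proof (rule gauge_equiv_of_cycles[OF same_permanents_adjoint[OF same] a0 _ nz])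
      show "cycle_112 s (adjoint_coeffs s b) = cycle_112 s a"
        using cycle_112_cases[OF same a0 b0] c1 True by (auto simp: cycles_adjoint)
      show "cycle_221 s (adjoint_coeffs s b) = cycle_221 s a"
        using cycle_221_cases[OF same a0 b0] False by (auto simp: cycles_adjoint)
    qed (simp add: adjoint_numerals b0)
    then show ?thesis by (simp add: gauge_or_adjoint_def)
  next
    case nt: False
    then show ?thesis using both_monomial_of_cycles[OF same a0 b0 nz c1 False] by simp
  qed
qed

lemma nonzero_case:
  assumes same: "same_permanents s a b" and a0: "a 0 = 0" and b0: "b 0 = 0"
    and nz: "a 1 \<noteq> 0" "a 2 \<noteq> 0" "a 3 \<noteq> 0" "a 4 \<noteq> 0"
  shows "gauge_or_adjoint a b \<or> both_monomial s a b"
proof (cases "cycle_112 s b = cycle_112 s a")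
  case True
  then show ?thesis using nonzero_case_112[OF same a0 b0 nz] by blast
next
  case n1: False
  show ?thesis
  proof (cases "cycle_221 s b = cycle_221 s a")
    case True
    \<comment> \<open>The first orbit is reversed and the second preserved. The square of
      \<open>s\<close> exchanges the orbits, which leads back to
      \<open>nonzero_case_112\<close>.\<close>
    interpret sq: cyclic5 "\<lambda>x. s (s x)" by (rule cyclic5_square)
    have "sq.gauge_or_adjoint (relabel a) (relabel b) \<or> both_monomial (\<lambda>x. s (s x)) (relabel a) (relabel b)"
      using nz True
      by (intro sq.nonzero_case_112 same_permanents_relabel same)
         (simp_all add: relabel_numerals cycles_relabel a0 b0)
    then show ?thesis
      using gauge_or_adjoint_relabel monomial_via_relabel unfolding both_monomial_def by blast
  next
    case False
    have "gauge_equiv s a (adjoint_coeffs s b)"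
    proof (rule gauge_equiv_of_cycles[OF same_permanents_adjoint[OF same] a0 _ nz])
      show "cycle_112 s (adjoint_coeffs s b) = cycle_112 s a"
        using cycle_112_cases[OF same a0 b0] n1 by (auto simp: cycles_adjoint)
      show "cycle_221 s (adjoint_coeffs s b) = cycle_221 s a"
        using cycle_221_cases[OF same a0 b0] False by (auto simp: cycles_adjoint)
    qed (simp add: adjoint_numerals b0)
    then show ?thesis by (simp add: gauge_or_adjoint_def)
  qed
qed

subsection \<open>Vanishing coefficients\<close>

text \<open>Only entries between cyclic neighbours are nonzero. Five indices cannot be paired off,
  so just the two rotations contribute.\<close>

lemma permanent_01234_14:
  assumes "a 0 = 0" "a 2 = 0" "a 3 = 0"
  shows "permanent {0, 1, 2, 3, 4} (dickson s a) = orbit_norm s (a 1) + orbit_norm s (a 4)"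
  using permanent_laplace[of "[0, 1, 2, 3, 4::nat]" "dickson s a"] assms
  by (simp add: dickson_def funpow_numerals s_0) (simp add: orbit_norm_def mult_ac)

lemma permanent_01234_23:
  assumes "a 0 = 0" "a 1 = 0" "a 4 = 0"
  shows "permanent {0, 1, 2, 3, 4} (dickson s a) = orbit_norm s (a 2) + orbit_norm s (a 3)"
  using permanent_laplace[of "[0, 1, 2, 3, 4::nat]" "dickson s a"] assms
  by (simp add: dickson_def funpow_numerals s_0) (simp add: orbit_norm_def mult_ac)

text \<open>Steps of length 1 or 2 modulo 5 that avoid the index 4 leave only the cycle through 0,
  1, 2, 3 in this order.\<close>

lemma permanent_0123_12:
  assumes "a 0 = 0" "a 3 = 0" "a 4 = 0"
  shows "permanent {0, 1, 2, 3} (dickson s a) = a 1 * s (a 1) * s (s (a 1)) * s (s (s (a 2)))"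
  using permanent_laplace[of "[0, 1, 2, 3::nat]" "dickson s a"] assms
  by (simp add: dickson_def funpow_numerals s_0 mult_ac)

text \<open>All 3-cycle products vanish, so the norm condition comes from the full permanent: the
  norms of coefficients 1 and 4 have known sum and product. If they are swapped, the adjoint is
  used.\<close>

lemma only_14_case:
  assumes same: "same_permanents s a b" and a0: "a 0 = 0" and b0: "b 0 = 0"
    and a: "a 1 \<noteq> 0" "a 4 \<noteq> 0" "a 2 = 0" "a 3 = 0"
  shows "gauge_or_adjoint a b"
proof -
  note p = pair_14[OF same a0 b0] pair_23[OF same a0 b0]
  have bnz: "b 1 \<noteq> 0" "b 4 \<noteq> 0" using p a by (metis mult_eq_0_iff s_eq_0_iff)+
  have "cycle_112 s b = 0" "cycle_112r s b = 0"
    using cycle_112_cases[OF same a0 b0] a by (auto simp: cycle_defs s_0)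
  then have b: "b 2 = 0" "b 3 = 0" using bnz by (simp_all add: cycle_defs s_simps)
  have main: "gauge_equiv s a c"
    if same: "same_permanents s a c" and c: "c 0 = 0" "c 1 \<noteq> 0" "c 2 = 0" "c 3 = 0"
      and N: "orbit_norm s (c 1) = orbit_norm s (a 1)" for c
  proof (rule gauge_equivI[where r = "c 1 / a 1"])
    have "s (s (s (s (a 1 * s (a 4))))) = s (s (s (s (c 1 * s (c 4)))))"
      by (simp only: pair_14[OF same a0 c(1)])
    then show "c 4 * s (s (s (s (c 1 / a 1)))) = a 4"
      using a by (simp add: s_simps field_simps)
    show "orbit_norm s (c 1 / a 1) = 1"
      using a N by (simp add: orbit_norm_divide) (simp add: orbit_norm_def s_simps)
  qed (use a0 a c in simp_all)
  have "orbit_norm s (a 1) * orbit_norm s (a 4) = orbit_norm s (b 1) * orbit_norm s (b 4)"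
    using arg_cong[OF p(1), of "orbit_norm s"] by (simp add: orbit_norm_mult orbit_norm_s)
  moreover have "orbit_norm s (a 1) + orbit_norm s (a 4) = orbit_norm s (b 1) + orbit_norm s (b 4)"
    using same_permanentsD[OF same, of "{0, 1, 2, 3, 4}"] a0 b0 a b by (simp add: permanent_01234_14)
  ultimately consider "orbit_norm s (b 1) = orbit_norm s (a 1)" | "orbit_norm s (b 4) = orbit_norm s (a 1)"
    using sum_prod_eq_cases by metis
  then show ?thesis
  proof cases
    case 1
    then show ?thesis using main[OF same] b0 b bnz by (simp add: gauge_or_adjoint_def)
  next
    case 2
    then show ?thesis
      using main[OF same_permanents_adjoint[OF same]] b0 b bnz
      by (simp add: gauge_or_adjoint_def adjoint_numerals orbit_norm_s s_simps)
  qed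
qed

text \<open>Since \<open>a 3 = 0\<close>, each orbit has one vanishing product. The nonzero
  \<open>cycle_112r s a\<close> decides between \<open>b\<close> and its adjoint and fixes
  coefficient 2; the second orbit gives the norm condition.\<close>

lemma only_124_case:
  assumes same: "same_permanents s a b" and a0: "a 0 = 0" and b0: "b 0 = 0"
    and a: "a 1 \<noteq> 0" "a 2 \<noteq> 0" "a 4 \<noteq> 0" "a 3 = 0"
  shows "gauge_or_adjoint a b"
proof -
  have main: "gauge_equiv s a c"
    if same: "same_permanents s a c" and c0: "c 0 = 0" and c: "cycle_112 s c = 0" "cycle_112r s c = cycle_112r s a" for c
  proof -
    note p = pair_14[OF same a0 c0]
    have cnz: "c 1 \<noteq> 0" "c 4 \<noteq> 0" using p a by (metis mult_eq_0_iff s_eq_0_iff)+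
    have c3: "c 3 = 0" using c(1) cnz by (simp add: cycle_defs s_simps)
    define r where "r = c 1 / a 1"
    have r0: "r \<noteq> 0" using a cnz by (simp add: r_def)
    have c1: "c 1 = a 1 * r" using a by (simp add: r_def)
    have sc4: "s (c 4) * r = s (a 4)" using p a by (simp add: c1)
    then have "s (s (s (s (s (c 4) * r)))) = a 4" by (simp add: s5)
    then have c4: "c 4 * s (s (s (s r))) = a 4" by (simp add: s_simps)
    have ssc4: "s (s (c 4)) * s r = s (s (a 4))"
      using arg_cong[OF sc4, of s] by (simp add: s_simps)
    have "c 2 * s (s (c 4)) * s (c 4) = a 2 * (s (s (c 4)) * s r) * s (a 4)"
      using c(2) by (simp only: cycle_defs ssc4)
    then have "c 2 * (s (s (c 4)) * s (c 4)) = a 2 * r * s r * (s (s (c 4)) * s (c 4))"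
      by (simp only: sc4[symmetric] mult_ac)
    then have c2: "c 2 = a 2 * r * s r" using cnz by (simp add: s_simps)
    have "cycle_221 s c = cycle_221 s a"
      using cycle_221_sum[OF same a0 c0] a c3 by (simp add: cycle_defs s_0)
    then have "orbit_norm s r = 1"
      using a by (simp add: cycle_defs c1 c2 s_simps orbit_norm_def mult_ac)
    then show ?thesis
      using c1 c2 c3 c4 a0 c0 a by (intro gauge_equivI[of a c r]) simp_all
  qed
  have z: "cycle_112 s a = 0" using a by (simp add: cycle_defs s_0)
  from cycle_112_cases[OF same a0 b0] show ?thesis
  proof
    assume "cycle_112 s b = cycle_112 s a \<and> cycle_112r s b = cycle_112r s a"
    then show ?thesis using main[OF same b0] z by (simp add: gauge_or_adjoint_def)
  next
    assume "cycle_112 s b = cycle_112r s a \<and> cycle_112r s b = cycle_112 s a"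
    then show ?thesis using main[OF same_permanents_adjoint[OF same]] z b0
      by (simp add: gauge_or_adjoint_def cycles_adjoint adjoint_numerals)
  qed
qed

lemma outer_nonzero_case:
  assumes same: "same_permanents s a b" and a0: "a 0 = 0" and b0: "b 0 = 0"
    and a: "a 1 \<noteq> 0" "a 4 \<noteq> 0" "a 2 = 0 \<or> a 3 = 0"
  shows "gauge_or_adjoint a b"
proof -
  consider "a 2 = 0" "a 3 = 0" | "a 2 \<noteq> 0" "a 3 = 0" | "a 2 = 0" "a 3 \<noteq> 0" using a(3) by blast
  then show ?thesis
  proof cases
    case 1
    then show ?thesis using only_14_case[OF same a0 b0] a by blast
  next
    case 2
    then show ?thesis using only_124_case[OF same a0 b0] a by blast
  next
    case 3
    then have "gauge_or_adjoint (adjoint_coeffs s a) b"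
      using a a0 b0 by (intro only_124_case same_permanents_adjoint_left same)
        (simp_all add: adjoint_numerals s_simps)
    then show ?thesis by (rule gauge_or_adjoint_left)
  qed
qed

text \<open>The pair products vanish, leaving the second 3-cycle and the 4-cycle on {0, 1, 2, 3}.
  Each gives a relation between the ratios \<open>r\<close> and \<open>q\<close>; suitable shifts by
  \<open>s\<close> combine to norm 1 for \<open>r\<close> and \<open>q = r * s r\<close>.\<close>

lemma only_12_case:
  assumes same: "same_permanents s a b" and a0: "a 0 = 0" and b0: "b 0 = 0"
    and a: "a 1 \<noteq> 0" "a 2 \<noteq> 0" "a 3 = 0" "a 4 = 0"
  shows "gauge_or_adjoint a b"
proof -
  have main: "gauge_equiv s a c"
    if same: "same_permanents s a c" and c0: "c 0 = 0" and c: "cycle_221 s c = cycle_221 s a" for c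
  proof -
    have cnz: "c 1 \<noteq> 0" "c 2 \<noteq> 0" using a c by (auto simp: cycle_defs s_simps)
    have cz: "c 3 = 0" "c 4 = 0"
      using pair_14[OF same a0 c0] pair_23[OF same a0 c0] a cnz by (simp_all add: s_simps)
    define r where "r = c 1 / a 1"
    define q where "q = c 2 / a 2"
    have r0: "r \<noteq> 0" "q \<noteq> 0" using a cnz by (simp_all add: r_def q_def)
    have c1: "c 1 = a 1 * r" and c2: "c 2 = a 2 * q" using a by (simp_all add: r_def q_def)
    have "c 1 * s (c 1) * s (s (c 1)) * s (s (s (c 2))) = a 1 * s (a 1) * s (s (a 1)) * s (s (s (a 2)))"
      using same_permanentsD[OF same, of "{0, 1, 2, 3}"] a0 c0 a cz by (simp add: permanent_0123_12)
    then have e: "r * s r * s (s r) * s (s (s q)) = 1"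
      using a by (simp add: c1 c2 s_simps mult_ac)
    have e1: "s (s r) * s (s (s r)) * s (s (s (s r))) * q = 1"
      using arg_cong[OF e, of "\<lambda>x. s (s x)"] by (simp add: s_simps)
    have e2: "s (s (s (s r))) * r * s r * s (s q) = 1"
      using arg_cong[OF e1, of "\<lambda>x. s (s x)"] by (simp add: s_simps)
    have e3: "q * s (s q) * s (s (s (s r))) = 1"
      using c a by (simp add: cycle_defs c1 c2 s_simps mult_ac)
    have "orbit_norm s r * (q * s (s q) * s (s (s (s r)))) =
        (s (s r) * s (s (s r)) * s (s (s (s r))) * q) * (s (s (s (s r))) * r * s r * s (s q))"
      by (simp only: orbit_norm_def mult_ac)
    then have N: "orbit_norm s r = 1" by (simp only: e1 e2 e3 mult_1_right)
    have "q * orbit_norm s r = (s (s r) * s (s (s r)) * s (s (s (s r))) * q) * (r * s r)"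
      by (simp only: orbit_norm_def mult_ac)
    then have "q = r * s r" by (simp only: N e1 mult_1 mult_1_right)
    then show ?thesis
      using N c1 c2 cz a0 c0 a by (intro gauge_equivI[of a c r]) (simp_all add: mult.assoc)
  qed
  from cycle_221_cases[OF same a0 b0] show ?thesis
  proof
    assume "cycle_221 s b = cycle_221 s a \<and> cycle_221r s b = cycle_221r s a"
    then show ?thesis using main[OF same b0] by (simp add: gauge_or_adjoint_def)
  next
    assume "cycle_221 s b = cycle_221r s a \<and> cycle_221r s b = cycle_221 s a"
    then show ?thesis using main[OF same_permanents_adjoint[OF same]] b0
      by (simp add: gauge_or_adjoint_def cycles_adjoint adjoint_numerals)
  qed
qed

text \<open>The supports are {1, 2}, {1, 3}, {2, 4} and {3, 4}. Passing to the square of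
  \<open>s\<close> takes {2, 4} to {1, 2}; adjoints exchange {1, 3} with {2, 4} and {3, 4} with {1,
  2}.\<close>

lemma two_term_case:
  assumes same: "same_permanents s a b" and a0: "a 0 = 0" and b0: "b 0 = 0"
    and a: "a 1 = 0 \<longleftrightarrow> a 4 \<noteq> 0" "a 2 = 0 \<longleftrightarrow> a 3 \<noteq> 0"
  shows "gauge_or_adjoint a b"
proof -
  interpret sq: cyclic5 "\<lambda>x. s (s x)" by (rule cyclic5_square)
  have case_24: "gauge_or_adjoint c b"
    if same: "same_permanents s c b" and c: "c 0 = 0" "c 1 = 0" "c 2 \<noteq> 0" "c 3 = 0" "c 4 \<noteq> 0" for c
    using c b0
    by (intro gauge_or_adjoint_relabel sq.only_12_case same_permanents_relabel same)
       (simp_all add: relabel_numerals)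
  have left: "same_permanents s (adjoint_coeffs s a) b" by (rule same_permanents_adjoint_left[OF same])
  consider "a 1 \<noteq> 0" "a 2 \<noteq> 0" "a 3 = 0" "a 4 = 0" | "a 1 \<noteq> 0" "a 2 = 0" "a 3 \<noteq> 0" "a 4 = 0"
    | "a 1 = 0" "a 2 \<noteq> 0" "a 3 = 0" "a 4 \<noteq> 0" | "a 1 = 0" "a 2 = 0" "a 3 \<noteq> 0" "a 4 \<noteq> 0"
    using a by blast
  then show ?thesis
  proof cases
    case 1
    then show ?thesis using only_12_case[OF same a0 b0] by blast
  next
    case 2
    then show ?thesis using a0
      by (intro gauge_or_adjoint_left[OF case_24] left) (simp_all add: adjoint_numerals s_simps)
  next
    case 3
    then show ?thesis using a0 by (intro case_24 same) simp_all
  next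
    case 4
    then show ?thesis using a0 b0
      by (intro gauge_or_adjoint_left[OF only_12_case] left) (simp_all add: adjoint_numerals s_simps)
  qed
qed

lemma single_coeff_of_support:
  assumes "a 0 = 0" and "a 1 = 0 \<or> a 4 = 0" "a 2 = 0 \<or> a 3 = 0"
    and "a 1 = 0 \<and> a 4 = 0 \<or> a 2 = 0 \<and> a 3 = 0"
    and "a 1 \<noteq> 0 \<or> a 2 \<noteq> 0 \<or> a 3 \<noteq> 0 \<or> a 4 \<noteq> 0"
  shows "single_coeff s (permanent {0, 1, 2, 3, 4} (dickson s a)) a"
proof -
  have L: "linearized s a x = a 1 * (s ^^ 1) x + a 2 * (s ^^ 2) x + a 3 * (s ^^ 3) x + a 4 * (s ^^ 4) x" for x
    by (simp add: linearized_def sum_less_5 assms(1))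
  have N0: "orbit_norm s 0 = 0" by (simp add: orbit_norm_def)
  consider "a 1 \<noteq> 0" "a 2 = 0" "a 3 = 0" "a 4 = 0" | "a 4 \<noteq> 0" "a 1 = 0" "a 2 = 0" "a 3 = 0"
    | "a 2 \<noteq> 0" "a 1 = 0" "a 3 = 0" "a 4 = 0" | "a 3 \<noteq> 0" "a 1 = 0" "a 2 = 0" "a 4 = 0"
    using assms by blast
  then show ?thesis
    by cases (auto simp: single_coeff_def L permanent_01234_14 permanent_01234_23 assms(1) N0)
qed

theorem same_permanents_cases:
  assumes same: "same_permanents s a b" and a0: "a 0 = 0" and b0: "b 0 = 0"
    and a: "a 1 \<noteq> 0 \<or> a 2 \<noteq> 0 \<or> a 3 \<noteq> 0 \<or> a 4 \<noteq> 0"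
    and b: "b 1 \<noteq> 0 \<or> b 2 \<noteq> 0 \<or> b 3 \<noteq> 0 \<or> b 4 \<noteq> 0"
  shows "gauge_or_adjoint a b \<or> both_monomial s a b \<or> (\<exists>t. single_coeff s t a \<and> single_coeff s t b)"
proof -
  interpret sq: cyclic5 "\<lambda>x. s (s x)" by (rule cyclic5_square)
  note p = pair_14[OF same a0 b0] pair_23[OF same a0 b0]
  consider "a 1 \<noteq> 0" "a 4 \<noteq> 0" "a 2 \<noteq> 0" "a 3 \<noteq> 0"
    | "a 1 \<noteq> 0" "a 4 \<noteq> 0" "a 2 = 0 \<or> a 3 = 0"
    | "a 2 \<noteq> 0" "a 3 \<noteq> 0" "a 1 = 0 \<or> a 4 = 0"
    | "a 1 = 0 \<longleftrightarrow> a 4 \<noteq> 0" "a 2 = 0 \<longleftrightarrow> a 3 \<noteq> 0"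
    | "a 1 = 0 \<or> a 4 = 0" "a 2 = 0 \<or> a 3 = 0" "a 1 = 0 \<and> a 4 = 0 \<or> a 2 = 0 \<and> a 3 = 0"
    by blast
  then show ?thesis
  proof cases
    case 1
    then show ?thesis using nonzero_case[OF same a0 b0] by blast
  next
    case 2
    then show ?thesis using outer_nonzero_case[OF same a0 b0] by blast
  next
    case 3
    then have "gauge_or_adjoint a b"
      using a0 b0 by (intro gauge_or_adjoint_relabel sq.outer_nonzero_case same_permanents_relabel same)
        (auto simp: relabel_numerals)
    then show ?thesis by blast
  next
    case 4
    then show ?thesis using two_term_case[OF same a0 b0] by blast
  next
    case 5
    \<comment> \<open>Here \<open>a\<close> has a single nonzero coefficient. The vanishing pair and
      3-cycle products force the same for \<open>b\<close>, and the full permanent is the norm of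
      that coefficient.\<close>
    have bz: "b 1 = 0 \<or> b 4 = 0" "b 2 = 0 \<or> b 3 = 0"
      using p 5(1,2) by (metis mult_eq_0_iff s_eq_0_iff)+
    have "cycle_112 s a = 0" "cycle_112r s a = 0" "cycle_221 s a = 0" "cycle_221r s a = 0"
      using 5 by (auto simp: cycle_defs s_0)
    then have "cycle_112 s b = 0" "cycle_112r s b = 0" "cycle_221 s b = 0" "cycle_221r s b = 0"
      using cycle_112_cases[OF same a0 b0] cycle_221_cases[OF same a0 b0] by auto
    then have "b 1 = 0 \<and> b 4 = 0 \<or> b 2 = 0 \<and> b 3 = 0"
      using bz by (auto simp: cycle_defs s_eq_0_iff)
    then show ?thesis
      using single_coeff_of_support[of a] single_coeff_of_support[of b] a0 b0 a b bz 5
        same_permanentsD[OF same, of "{0, 1, 2, 3, 4}"] by auto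
  qed
qed

end

subsection \<open>Power sums over a finite field\<close>

lemma power_card_minus_1:
  fixes x :: "'a::{field, finite}"
  assumes "x \<noteq> 0"
  shows "x ^ (CARD('a) - 1) = 1"
proof -
  have "bij_betw ((*) x) (UNIV - {0}) (UNIV - {0})"
    using assms by (intro bij_betwI[where g = "\<lambda>y. y / x"]) auto
  then have "(\<Prod>y\<in>UNIV - {0}. y) = (\<Prod>y\<in>UNIV - {0}. x * y)"
    by (rule prod.reindex_bij_betw[symmetric])
  also have "\<dots> = x ^ (CARD('a) - 1) * (\<Prod>y\<in>UNIV - {0}. y)"
    by (simp add: prod.distrib card_Diff_singleton)
  finally have "(\<Prod>y\<in>UNIV - {0::'a}. y) * (x ^ (CARD('a) - 1) - 1) = 0"
    by (simp add: algebra_simps)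
  then show ?thesis by simp
qed

text \<open>Translating the sum of all elements of \<open>V\<close> by a nonzero \<open>v \<in> V\<close> changes it by \<open>card V * v\<close>.\<close>

lemma of_nat_card_additive_eq_0:
  fixes V :: "'a::field set"
  assumes "finite V" and add: "\<And>x y. x \<in> V \<Longrightarrow> y \<in> V \<Longrightarrow> x + y \<in> V"
    and v: "v \<in> V" "v \<noteq> 0"
  shows "of_nat (card V) = (0::'a)"
proof -
  have inj: "inj_on (\<lambda>x. x + v) V" by simp
  have "(\<lambda>x. x + v) ` V = V"
    using assms by (intro endo_inj_surj) auto
  then have "(\<Sum>x\<in>V. x) = (\<Sum>x\<in>(\<lambda>x. x + v) ` V. x)" by simp
  also have "\<dots> = (\<Sum>x\<in>V. x) + of_nat (card V) * v"
    by (simp add: sum.reindex[OF inj] sum.distrib)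
  finally show ?thesis using v(2) by simp
qed

lemma of_nat_CARD_eq_0: "of_nat CARD('a) = (0::'a::{field, finite})"
  by (rule of_nat_card_additive_eq_0[of _ 1]) simp_all

text \<open>A fibre together with 0 is a nontrivial finite additive group, whose cardinality is 0 in
  the field; so the fibre itself counts as -1.\<close>

lemma sum_ratio_eq_sum_image:
  fixes F h :: "'a::{field, finite} \<Rightarrow> 'a"
  assumes add: "\<And>x y. F (x + y) = F x + F y"
  shows "(\<Sum>x\<in>UNIV - {0}. h (F x / x)) = - (\<Sum>c\<in>{F x / x | x. x \<noteq> 0}. h c)"
proof -
  let ?I = "{F x / x | x. x \<noteq> 0}"
  have fib: "of_nat (card {x \<in> UNIV - {0}. F x / x = c}) = (- 1 :: 'a)" (is "of_nat (card ?B) = _") if c: "c \<in> ?I" for c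
  proof -
    obtain v where v: "v \<noteq> 0" "F v / v = c" using c by blast
    have "F 0 = 0" using add[of 0 0] by (metis add_cancel_right_right add_0)
    then have V: "{x. F x = c * x} = insert 0 ?B" by (auto simp: field_simps)
    have "of_nat (card {x. F x = c * x}) = (0::'a)"
      using v by (intro of_nat_card_additive_eq_0[of _ v]) (auto simp: add algebra_simps)
    then show ?thesis unfolding V by (simp add: eq_neg_iff_add_eq_0 add.commute)
  qed
  have "(\<Sum>x\<in>UNIV - {0}. h (F x / x)) = (\<Sum>c\<in>?I. \<Sum>x\<in>{x \<in> UNIV - {0}. F x / x = c}. h (F x / x))"
    by (rule sum.group[symmetric]) auto
  also have "\<dots> = (\<Sum>c\<in>?I. of_nat (card {x \<in> UNIV - {0}. F x / x = c}) * h c)"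
    by (intro sum.cong refl) simp
  also have "\<dots> = (\<Sum>c\<in>?I. - h c)"
    by (intro sum.cong refl) (simp only: fib mult_minus1)
  finally show ?thesis by (simp add: sum_negf)
qed

text \<open>If the remainder \<open>e\<close> of the difference were positive, X^e - 1 would have
  more roots than its degree allows.\<close>

lemma cong_of_power_eq:
  assumes "\<And>x::'a::{field, finite}. x \<noteq> 0 \<Longrightarrow> x ^ k = x ^ l"
  shows "[k = l] (mod (CARD('a) - 1))"
proof -
  let ?M = "CARD('a) - 1"
  have card2: "?M > 0"
  proof -
    have "card {0::'a, 1} \<le> CARD('a)" by (rule card_mono) simp_all
    then show ?thesis by simp
  qed
  have main: "[k = l] (mod ?M)"
    if lk: "l \<le> k" and eq: "\<And>x::'a. x \<noteq> 0 \<Longrightarrow> x ^ k = x ^ l" for k l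
  proof -
    define e where "e = (k - l) mod ?M"
    have e1: "x ^ e = 1" if "x \<noteq> 0" for x :: 'a
    proof -
      have "x ^ l * x ^ (k - l) = x ^ l" using lk eq[OF that] by (simp flip: power_add)
      then have "x ^ (k - l) = 1" using that by simp
      moreover have "x ^ (k - l) = (x ^ ?M) ^ ((k - l) div ?M) * x ^ e"
        by (simp add: e_def flip: power_mult power_add)
      ultimately show ?thesis by (simp only: power_card_minus_1[OF that] power_one mult_1)
    qed
    have "e = 0"
    proof (rule ccontr)
      assume "e \<noteq> 0"
      let ?p = "monom 1 e - 1 :: 'a poly"
      have "poly ?p 0 = -1" using \<open>e \<noteq> 0\<close> by (simp add: poly_monom power_0_left)
      then have "?p \<noteq> 0" by auto
      then have "card {x. poly ?p x = 0} \<le> degree ?p" by (rule card_poly_roots_bound)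
      also have "\<dots> \<le> e" by (rule degree_diff_le) (simp_all add: degree_monom_le)
      also have "e < ?M" using card2 by (simp add: e_def)
      also have "?M = card (UNIV - {0::'a})" by (simp add: card_Diff_singleton)
      also have "\<dots> \<le> card {x. poly ?p x = 0}"
        by (rule card_mono) (auto simp: poly_monom e1)
      finally show False by simp
    qed
    then show ?thesis using lk by (simp add: e_def cong_altdef_nat mod_eq_0_iff_dvd)
  qed
  show ?thesis
  proof (cases "l \<le> k")
    case True
    then show ?thesis using main assms by blast
  next
    case False
    then have "[l = k] (mod ?M)" using main[of k l] assms by simp
    then show ?thesis by (rule cong_sym)
  qed
qed

text \<open>Substituting \<open>y * x\<close> for \<open>x\<close> multiplies the sum by
  \<open>y ^ k / y ^ l\<close>, which differs from 1 for a suitable \<open>y\<close>.\<close>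

lemma sum_power_ratio_eq_0:
  assumes "\<not> [k = l] (mod (CARD('a) - 1))"
  shows "(\<Sum>x\<in>UNIV - {0::'a::{field, finite}}. x ^ k / x ^ l) = 0"
proof -
  obtain y :: 'a where y: "y \<noteq> 0" "y ^ k \<noteq> y ^ l"
    using cong_of_power_eq assms by blast
  let ?S = "\<Sum>x\<in>UNIV - {0::'a}. x ^ k / x ^ l"
  have "bij_betw ((*) y) (UNIV - {0}) (UNIV - {0})"
    using y by (intro bij_betwI[where g = "\<lambda>x. x / y"]) auto
  then have "?S = (\<Sum>x\<in>UNIV - {0}. (y * x) ^ k / (y * x) ^ l)"
    by (rule sum.reindex_bij_betw[symmetric])
  also have "\<dots> = y ^ k / y ^ l * ?S"
    by (simp add: power_mult_distrib sum_distrib_left)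
  finally have "(y ^ k / y ^ l - 1) * ?S = 0" by (simp add: algebra_simps)
  moreover have "y ^ k / y ^ l - 1 \<noteq> 0" using y by simp
  ultimately show ?thesis by (metis mult_eq_0_iff)
qed

section \<open>Digit representations modulo \<open>q ^ n - 1\<close>\<close>

lemma base_digits_eq:
  fixes c d :: "nat \<Rightarrow> nat"
  assumes "\<And>j. j < n \<Longrightarrow> c j < q" "\<And>j. j < n \<Longrightarrow> d j < q"
    and "(\<Sum>j<n. c j * q ^ j) = (\<Sum>j<n. d j * q ^ j)" and "j < n"
  shows "c j = d j"
  using assms
proof (induction n arbitrary: c d j)
  case (Suc n)
  have split: "(\<Sum>j<Suc n. e j * q ^ j) = e 0 + q * (\<Sum>j<n. e (Suc j) * q ^ j)" for e :: "nat \<Rightarrow> nat"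
    by (subst sum.lessThan_Suc_shift) (simp add: sum_distrib_left mult_ac)
  have q: "q > 0" using Suc.prems(1)[of 0] by simp
  have lt: "c 0 < q" "d 0 < q" using Suc.prems(1,2) by simp_all
  have eq: "c 0 + q * (\<Sum>j<n. c (Suc j) * q ^ j) = d 0 + q * (\<Sum>j<n. d (Suc j) * q ^ j)"
    using Suc.prems(3) by (simp only: split)
  then have "(c 0 + q * (\<Sum>j<n. c (Suc j) * q ^ j)) mod q = (d 0 + q * (\<Sum>j<n. d (Suc j) * q ^ j)) mod q"
    by simp
  then have 0: "c 0 = d 0" using lt by simp
  then have s: "(\<Sum>j<n. c (Suc j) * q ^ j) = (\<Sum>j<n. d (Suc j) * q ^ j)"
    using eq q by simp
  have IH: "c (Suc j) = d (Suc j)" if "j < n" for j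
    using Suc.IH[of "\<lambda>j. c (Suc j)" "\<lambda>j. d (Suc j)" j] Suc.prems(1,2) s that by simp
  show ?case using 0 IH Suc.prems(4) by (cases j) auto
qed simp

lemma sum_digits_less:
  fixes c :: "nat \<Rightarrow> nat"
  assumes "\<And>j. j < n \<Longrightarrow> c j < q"
  shows "(\<Sum>j<n. c j * q ^ j) < q ^ n"
  using assms
proof (induction n)
  case (Suc n)
  have "(\<Sum>j<Suc n. c j * q ^ j) < q ^ n + c n * q ^ n" using Suc by simp
  also have "\<dots> = Suc (c n) * q ^ n" by simp
  also have "\<dots> \<le> q * q ^ n" using Suc.prems[of n] by (intro mult_right_mono) auto
  finally show ?case by simp
qed simp

text \<open>The range starts at 1 because 0 and \<open>m\<close> are congruent.\<close>

lemma nat_cong_positive_le_eq: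
  fixes x y m :: nat
  assumes "[x = y] (mod m)" "0 < x" "x \<le> m" "0 < y" "y \<le> m"
  shows "x = y"
proof -
  have "[int x = int y] (mod int m)" using assms(1) by (simp add: cong_int_iff)
  then have "int m dvd int x - int y" by (simp add: cong_iff_dvd_diff)
  moreover have "\<bar>int x - int y\<bar> < int m" using assms by auto
  ultimately show ?thesis using dvd_imp_le_int[of "int x - int y" "int m"] by force
qed

text \<open>Carrying \<open>q\<close> units of a digit to the next position, cyclically, keeps the residue modulo
  \<open>q ^ n - 1\<close> and lowers the digit sum, so a representation of minimal digit sum is unique.\<close>

lemma cyclic_digits_eq:
  fixes c d :: "nat \<Rightarrow> nat"
  assumes q: "q \<ge> 2" and d: "\<And>j. j < n \<Longrightarrow> d j < q"
    and le: "(\<Sum>j<n. c j) \<le> (\<Sum>j<n. d j)" and pos: "0 < (\<Sum>j<n. c j)"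
    and cong: "[(\<Sum>j<n. c j * q ^ j) = (\<Sum>j<n. d j * q ^ j)] (mod (q ^ n - 1))"
    and "i < n"
  shows "c i = d i"
  using le pos cong \<open>i < n\<close>
proof (induction "\<Sum>j<n. c j" arbitrary: c i rule: less_induct)
  case less
  show ?case
  proof (cases "\<forall>j<n. c j < q")
    case True
    have pos': "0 < (\<Sum>j<n. e j * q ^ j)" if "0 < (\<Sum>j<n. e j)" for e :: "nat \<Rightarrow> nat"
    proof -
      have "(\<Sum>j<n. e j) \<le> (\<Sum>j<n. e j * q ^ j)" using q by (intro sum_mono) simp
      then show ?thesis using that by simp
    qed
    have "(\<Sum>j<n. c j * q ^ j) = (\<Sum>j<n. d j * q ^ j)"
    proof (rule nat_cong_positive_le_eq[OF less.prems(3)])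
      show "(\<Sum>j<n. c j * q ^ j) \<le> q ^ n - 1" "(\<Sum>j<n. d j * q ^ j) \<le> q ^ n - 1"
        using sum_digits_less[of n c q] sum_digits_less[of n d q] True d by simp_all
    qed (use less.prems pos' in auto)
    then show ?thesis using base_digits_eq[of n c q d i] True d less.prems(4) by blast
  next
    case False
    then obtain j where j: "j < n" "q \<le> c j" by auto
    define k where "k = (if Suc j < n then Suc j else 0)"
    have k: "k < n" using j by (auto simp: k_def)
    \<comment> \<open>One carry from \<open>j\<close> to its cyclic successor \<open>k\<close>; the
      wrap to position 0 works because q^n is 1 modulo q^n - 1.\<close>
    define c' where "c' = (\<lambda>i. (if i = j then c i - q else c i) + (if i = k then 1 else 0))"
    have c'': "c' i + (if i = j then q else 0) = c i + (if i = k then 1 else 0)" for i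
      using j by (simp add: c'_def)
    have weighted: "(\<Sum>i<n. c' i * w i) + q * w j = (\<Sum>i<n. c i * w i) + w k" for w :: "nat \<Rightarrow> nat"
    proof -
      have "(\<Sum>i<n. (c' i + (if i = j then q else 0)) * w i) = (\<Sum>i<n. (c i + (if i = k then 1 else 0)) * w i)"
        by (simp only: c'')
      then show ?thesis
        using j k by (simp add: distrib_right sum.distrib if_distrib[of "\<lambda>x. x * _"] sum.delta cong: if_cong)
    qed
    have size: "(\<Sum>i<n. c' i) + q = (\<Sum>i<n. c i) + 1" using weighted[of "\<lambda>_. 1"] by simp
    have qk: "[q * q ^ j = q ^ k] (mod (q ^ n - 1))"
    proof (cases "Suc j < n")
      case False
      then have "n = Suc j" using j by simp
      moreover have "q ^ n \<ge> 1" using q by simp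
      ultimately show ?thesis using False by (simp add: k_def cong_altdef_nat)
    qed (simp add: k_def)
    have "[(\<Sum>i<n. c' i * q ^ i) + q * q ^ j = (\<Sum>i<n. d i * q ^ i) + q * q ^ j] (mod (q ^ n - 1))"
      unfolding weighted using cong_add[OF less.prems(3) cong_sym[OF qk]] .
    then have "[(\<Sum>i<n. c' i * q ^ i) = (\<Sum>i<n. d i * q ^ i)] (mod (q ^ n - 1))"
      by (rule cong_add_rcancel_nat[THEN iffD1])
    moreover have "c j \<le> (\<Sum>i<n. c i)" using j by (intro member_le_sum) auto
    ultimately have "c' i = d i" if "i < n" for i
      using size q j less.prems(1) that by (intro less.hyps) auto
    \<comment> \<open>By \<open>size\<close> the digit sum of \<open>c'\<close> lies below that of
      \<open>c\<close>, hence below that of \<open>d\<close>; so this equality is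
      contradictory.\<close>
    then have "(\<Sum>i<n. c' i) = (\<Sum>i<n. d i)" by simp
    then show ?thesis using size q less.prems(1) by simp
  qed
qed

text \<open>The multiplicities \<open>c\<close> of the values of \<open>t\<close> and the indicator
  \<open>d\<close> of \<open>S\<close> are digit sequences with equal digit sum and congruent
  values. They coincide, so \<open>t\<close> takes each value in \<open>S\<close> exactly once and
  no other.\<close>

lemma sum_powers_cong_imp_permutation:
  assumes q: "q \<ge> (2::nat)" and S: "S \<subseteq> {..<n}" "S \<noteq> {}" and t: "t \<in> S \<rightarrow> {..<n}"
    and cong: "[(\<Sum>i\<in>S. q ^ t i) = (\<Sum>i\<in>S. q ^ i)] (mod (q ^ n - 1))"
  shows "t \<in> S \<rightarrow> S \<and> inj_on t S"
proof -
  have fin: "finite S" using S(1) by (rule finite_subset) simp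
  define c where "c = (\<lambda>j. card {i \<in> S. t i = j})"
  define d where "d = (\<lambda>j. if j \<in> S then 1 else (0::nat))"
  have c: "(\<Sum>j<n. c j * w j) = (\<Sum>i\<in>S. w (t i))" for w :: "nat \<Rightarrow> nat"
  proof -
    have "(\<Sum>i\<in>S. w (t i)) = (\<Sum>j<n. \<Sum>i\<in>{i \<in> S. t i = j}. w (t i))"
      using t fin by (intro sum.group[symmetric]) auto
    also have "\<dots> = (\<Sum>j<n. c j * w j)" by (intro sum.cong refl) (simp add: c_def)
    finally show ?thesis by simp
  qed
  have d: "(\<Sum>j<n. d j * w j) = (\<Sum>i\<in>S. w i)" for w :: "nat \<Rightarrow> nat"
    using S(1) by (simp add: d_def if_distrib[of "\<lambda>x. x * _"] sum.If_cases Int_absorb1 cong: if_cong)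
  have size: "(\<Sum>j<n. c j) = card S" "(\<Sum>j<n. d j) = card S"
    using c[of "\<lambda>_. 1"] d[of "\<lambda>_. 1"] by simp_all
  have cd: "c j = d j" if "j < n" for j
  proof (rule cyclic_digits_eq[OF q _ _ _ _ that])
    show "d j < q" for j using q by (simp add: d_def)
    show "0 < (\<Sum>j<n. c j)" using S fin by (simp add: size card_gt_0_iff)
  qed (use cong in \<open>simp_all add: size c d\<close>)
  have "t i \<in> S" if "i \<in> S" for i
  proof (rule ccontr)
    assume "t i \<notin> S"
    then have "c (t i) = 0" using cd[of "t i"] t that by (auto simp: d_def)
    then show False using that fin by (auto simp: c_def card_eq_0_iff)
  qed
  moreover have "i = i'" if "i \<in> S" "i' \<in> S" "t i = t i'" for i i'
  proof -
    have "t i < n" using t that(1) by auto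
    from cd[OF this] have "card {k \<in> S. t k = t i} \<le> 1" by (simp add: d_def c_def)
    then show ?thesis using card_le_Suc0_iff_eq[of "{k \<in> S. t k = t i}"] fin that by auto
  qed
  ultimately show ?thesis by (auto intro: inj_onI)
qed

subsection \<open>The Frobenius automorphism\<close>

context cyclic5
begin

lemma s_pow_add: "(s ^^ i) (x + y) = (s ^^ i) x + (s ^^ i) y"
  by (induction i) (simp_all add: s_add)

lemma s_pow_sum: "(s ^^ i) (\<Sum>k\<in>K. h k) = (\<Sum>k\<in>K. (s ^^ i) (h k))"
  by (induction K rule: infinite_finite_induct) (simp_all add: s_pow_add s_pow_0)

lemma s_pow_linearized:
  assumes i: "i < 5"
  shows "(s ^^ i) (linearized s a x) = (\<Sum>j<5. dickson s a i j * (s ^^ j) x)"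
proof -
  have "bij_betw (\<lambda>j. (j + 5 - i) mod 5) {..<5} {..<5}"
  proof (rule bij_betwI[where g = "\<lambda>k. (i + k) mod 5"])
    have "\<forall>i<5. \<forall>j<5. (i + (j + 5 - i) mod 5) mod 5 = j \<and> ((i + j) mod 5 + 5 - i) mod 5 = (j::nat)"
      unfolding all_less_5 by simp
    then show "(i + (j + 5 - i) mod 5) mod 5 = j" "((i + j) mod 5 + 5 - i) mod 5 = j" if "j \<in> {..<5}" for j
      using i that by auto
  qed auto
  then have "(\<Sum>k<5. (s ^^ i) (a k) * (s ^^ ((i + k) mod 5)) x) =
      (\<Sum>j<5. (s ^^ i) (a ((j + 5 - i) mod 5)) * (s ^^ ((i + (j + 5 - i) mod 5) mod 5)) x)"
    by (rule sum.reindex_bij_betw[symmetric])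
  also have "\<dots> = (\<Sum>j<5. dickson s a i j * (s ^^ j) x)"
  proof (intro sum.cong refl)
    fix j :: nat assume "j \<in> {..<5}"
    then have "(i + (j + 5 - i) mod 5) mod 5 = j" using i by (simp add: mod_add_right_eq)
    then show "(s ^^ i) (a ((j + 5 - i) mod 5)) * (s ^^ ((i + (j + 5 - i) mod 5) mod 5)) x =
        dickson s a i j * (s ^^ j) x" by (simp only: dickson_def)
  qed
  finally show ?thesis
    unfolding linearized_def s_pow_sum s_pow_mult s_pow_pow .
qed

lemma linearized_add: "linearized s a (x + y) = linearized s a x + linearized s a y"
  by (simp add: linearized_def s_pow_add distrib_left sum.distrib)

end

lemma frobenius_funpow: "((\<lambda>x::'a::monoid_mult. x ^ q) ^^ i) x = x ^ (q ^ i)"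
  by (induction i) (simp_all add: mult.commute flip: power_mult)

lemma frobenius_cyclic5:
  assumes q: "primepow q" and card: "CARD('a::{field, finite}) = q ^ 5"
  shows "cyclic5 (\<lambda>x::'a. x ^ q)"
proof
  have q1: "1 < q" using primepow_gt_Suc_0[OF q] by simp
  obtain p k where pk: "prime p" "q = p ^ k" using q by (auto simp: primepow_def)
  have "CHAR('a) > 0" by (rule finite_imp_CHAR_pos) simp
  then have prime: "prime CHAR('a)" by (rule prime_CHAR_semidom)
  have "CHAR('a) dvd q ^ 5"
    using of_nat_CARD_eq_0[where 'a = 'a] unfolding card of_nat_eq_0_iff_char_dvd .
  then have "CHAR('a) dvd p" using prime unfolding pk by (metis prime_dvd_power)
  then have char: "CHAR('a) = p" using pk prime by (simp add: primes_dvd_imp_eq)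
  show add: "(x + y) ^ q = x ^ q + y ^ q" for x y :: 'a
    by (rule freshmans_dream'[OF prime, of _ k]) (simp add: pk char)
  show "(x * y) ^ q = x ^ q * y ^ q" for x y :: 'a by (rule power_mult_distrib)
  have q5: "((((x ^ q) ^ q) ^ q) ^ q) ^ q = x ^ CARD('a)" for x :: 'a
    by (simp add: card eval_nat_numeral mult.assoc flip: power_mult)
  have "x ^ CARD('a) = x" for x :: 'a
  proof (cases "x = 0")
    case False
    have "x ^ CARD('a) = x * x ^ (CARD('a) - 1)" by (simp flip: power_Suc)
    then show ?thesis using power_card_minus_1[OF False] by simp
  qed simp
  then show s5: "((((x ^ q) ^ q) ^ q) ^ q) ^ q = x" for x :: 'a by (simp only: q5)
  show "\<exists>l. l \<noteq> 0 \<and> l ^ q = r * l" if r: "orbit_norm (\<lambda>x. x ^ q) r = 1" for r :: 'a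
  proof -
    define r1 where "r1 = r ^ q"
    define r2 where "r2 = r1 ^ q"
    define r3 where "r3 = r2 ^ q"
    define r4 where "r4 = r3 ^ q"
    have N: "r * r1 * r2 * r3 * r4 = 1"
      using r by (simp add: orbit_norm_def r1_def r2_def r3_def r4_def)
    \<comment> \<open>the Lagrange resolvent of \<open>r\<close>\<close>
    define P where "P = monom 1 1 + monom r q + monom (r * r1) (q ^ 2) + monom (r * r1 * r2) (q ^ 3)
      + monom (r * r1 * r2 * r3) (q ^ 4)"
    have "coeff P 1 = 1"
      using q1 by (simp add: P_def)
    then have "P \<noteq> 0" by auto
    then have "card {x. poly P x = 0} \<le> degree P" by (rule card_poly_roots_bound)
    also have "degree P \<le> q ^ 4"
    proof -
      have "q ^ i \<le> q ^ 4" if "i \<le> 4" for i using q1 that by (intro power_increasing) auto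
      from this[of 0] this[of 1] this[of 2] this[of 3]
      show ?thesis unfolding P_def
        by (intro degree_add_le order.trans[OF degree_monom_le]) simp_all
    qed
    also have "q ^ 4 < CARD('a)" using q1 by (simp add: card power_strict_increasing)
    finally have "{x. poly P x = 0} \<noteq> UNIV" by auto
    then obtain \<theta> where \<theta>: "poly P \<theta> \<noteq> 0" by blast
    have q_pow: "x ^ q ^ 2 = (x ^ q) ^ q" "x ^ q ^ 3 = ((x ^ q) ^ q) ^ q" "x ^ q ^ 4 = (((x ^ q) ^ q) ^ q) ^ q" for x :: 'a
      by (simp_all add: eval_nat_numeral mult.assoc flip: power_mult)
    have "poly P \<theta> = \<theta> + r * \<theta> ^ q + r * r1 * (\<theta> ^ q) ^ q + r * r1 * r2 * ((\<theta> ^ q) ^ q) ^ q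
        + r * r1 * r2 * r3 * (((\<theta> ^ q) ^ q) ^ q) ^ q"
      by (simp add: P_def poly_monom q_pow)
    \<comment> \<open>The Frobenius map shifts the summands of the resolvent cyclically, and norm 1
      closes the cycle.\<close>
    then have "r * poly P \<theta> ^ q = r * \<theta> ^ q + r * r1 * (\<theta> ^ q) ^ q + r * r1 * r2 * ((\<theta> ^ q) ^ q) ^ q
        + r * r1 * r2 * r3 * (((\<theta> ^ q) ^ q) ^ q) ^ q + r * r1 * r2 * r3 * r4 * \<theta>"
      by (simp only: add power_mult_distrib s5 distrib_left mult.assoc flip: r1_def r2_def r3_def r4_def)
    also have "\<dots> = poly P \<theta>"
      by (simp add: N P_def poly_monom q_pow)
    finally have "(1 / poly P \<theta>) ^ q = r * (1 / poly P \<theta>)"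
      using \<theta> by (simp add: power_divide field_simps)
    then show ?thesis using \<theta> by (intro exI[of _ "1 / poly P \<theta>"]) simp
  qed
qed simp

text \<open>Multiplying out gives one term for each map \<open>t\<close> from \<open>S\<close> to
  the five indices. Its sum over x vanishes unless the exponents agree modulo q^5 - 1, which forces
  \<open>t\<close> to permute \<open>S\<close>; then q^5 - 1 summands equal to 1 give -1.\<close>

lemma sum_prod_frobenius_ratio:
  assumes q: "primepow q" and card: "CARD('a::{field, finite}) = q ^ 5"
    and S: "S \<subseteq> {..<5}" "S \<noteq> {}"
  defines "s \<equiv> \<lambda>x::'a. x ^ q"
  shows "(\<Sum>x\<in>UNIV - {0}. \<Prod>i\<in>S. (s ^^ i) (linearized s a x / x)) = - permanent S (dickson s a)"
proof -
  interpret cyclic5 s unfolding s_def by (rule frobenius_cyclic5[OF q card])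
  have q2: "q \<ge> 2" using primepow_gt_Suc_0[OF q] by simp
  have fin: "finite S" using S(1) by (rule finite_subset) simp
  let ?T = "S \<rightarrow>\<^sub>E {..<5::nat}"
  have pow: "(s ^^ i) x = x ^ (q ^ i)" for i x unfolding s_def by (rule frobenius_funpow)
  have inner: "(\<Sum>x\<in>UNIV - {0::'a}. \<Prod>i\<in>S. (s ^^ t i) x / (s ^^ i) x) = (if t \<in> S \<rightarrow> S \<and> inj_on t S then - 1 else 0)"
    if t: "t \<in> ?T" for t
  proof -
    have e: "(\<Prod>i\<in>S. (s ^^ t i) x / (s ^^ i) x) = x ^ (\<Sum>i\<in>S. q ^ t i) / x ^ (\<Sum>i\<in>S. q ^ i)" for x
      by (simp add: pow prod_dividef power_sum)
    show ?thesis
    proof (cases "t \<in> S \<rightarrow> S \<and> inj_on t S")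
      case True
      then have "t ` S = S" using fin by (intro endo_inj_surj) auto
      then have "(\<Sum>i\<in>S. q ^ t i) = (\<Sum>i\<in>S. q ^ i)"
        using True sum.reindex[of t S "\<lambda>i. q ^ i"] by simp
      then have "(\<Sum>x\<in>UNIV - {0::'a}. \<Prod>i\<in>S. (s ^^ t i) x / (s ^^ i) x) = (\<Sum>x\<in>UNIV - {0::'a}. 1)"
        unfolding e by (intro sum.cong refl) simp
      also have "\<dots> = of_nat CARD('a) - 1"
      proof -
        have "CARD('a) > 0" by simp
        then obtain m where "CARD('a) = Suc m" using gr0_conv_Suc by blast
        then show ?thesis by (simp add: card_Diff_singleton)
      qed
      finally show ?thesis using True by (simp add: of_nat_CARD_eq_0)
    next
      case False
      have "\<not> [(\<Sum>i\<in>S. q ^ t i) = (\<Sum>i\<in>S. q ^ i)] (mod (CARD('a) - 1))"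
      proof
        assume "[(\<Sum>i\<in>S. q ^ t i) = (\<Sum>i\<in>S. q ^ i)] (mod (CARD('a) - 1))"
        then show False
          using False t sum_powers_cong_imp_permutation[OF q2 S, of t] unfolding card PiE_def by blast
      qed
      then show ?thesis unfolding e using False by (simp add: sum_power_ratio_eq_0)
    qed
  qed
  have "(\<Sum>x\<in>UNIV - {0}. \<Prod>i\<in>S. (s ^^ i) (linearized s a x / x)) =
      (\<Sum>x\<in>UNIV - {0}. \<Prod>i\<in>S. \<Sum>j<5. dickson s a i j * ((s ^^ j) x / (s ^^ i) x))"
    using S(1) by (intro sum.cong prod.cong refl) (auto simp: s_pow_divide s_pow_linearized sum_divide_distrib)
  also have "\<dots> = (\<Sum>x\<in>UNIV - {0}. \<Sum>t\<in>?T. \<Prod>i\<in>S. dickson s a i (t i) * ((s ^^ t i) x / (s ^^ i) x))"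
    using fin by (simp add: prod_sum_PiE)
  also have "\<dots> = (\<Sum>t\<in>?T. \<Sum>x\<in>UNIV - {0}. \<Prod>i\<in>S. dickson s a i (t i) * ((s ^^ t i) x / (s ^^ i) x))"
    by (rule sum.swap)
  also have "\<dots> = (\<Sum>t\<in>?T. (\<Prod>i\<in>S. dickson s a i (t i)) * (\<Sum>x\<in>UNIV - {0}. \<Prod>i\<in>S. (s ^^ t i) x / (s ^^ i) x))"
    by (simp only: prod.distrib sum_distrib_left)
  also have "\<dots> = (\<Sum>t\<in>?T. if t \<in> S \<rightarrow> S \<and> inj_on t S then - (\<Prod>i\<in>S. dickson s a i (t i)) else 0)"
    by (intro sum.cong refl) (simp add: inner)
  also have "\<dots> = (\<Sum>t | t \<in> S \<rightarrow>\<^sub>E S \<and> inj_on t S. - (\<Prod>i\<in>S. dickson s a i (t i)))"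
  proof -
    have "{t \<in> ?T. t \<in> S \<rightarrow> S \<and> inj_on t S} = {t. t \<in> S \<rightarrow>\<^sub>E S \<and> inj_on t S}"
      using S(1) by (auto simp: PiE_def)
    moreover have "finite ?T" using fin by (intro finite_PiE) simp_all
    ultimately show ?thesis by (simp flip: sum.inter_filter)
  qed
  finally show ?thesis
    by (simp add: permanent_eq_sum_injective[OF fin] sum_negf)
qed

lemma same_permanents_of_image_eq:
  assumes q: "primepow q" and card: "CARD('a::{field, finite}) = q ^ 5"
  defines "s \<equiv> \<lambda>x::'a. x ^ q"
  assumes eq: "{linearized s a x / x | x. x \<noteq> 0} = {linearized s b x / x | x. x \<noteq> 0}"
  shows "same_permanents s a b"
  unfolding same_permanents_def
proof (intro allI impI)
  interpret cyclic5 s unfolding s_def by (rule frobenius_cyclic5[OF q card])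
  fix S :: "nat set" assume S: "S \<subseteq> {..<5}"
  show "permanent S (dickson s a) = permanent S (dickson s b)"
  proof (cases "S = {}")
    case False
    have "- permanent S (dickson s c) = - (\<Sum>y\<in>{linearized s c x / x | x. x \<noteq> 0}. \<Prod>i\<in>S. (s ^^ i) y)" for c
    proof -
      have "(\<Sum>x\<in>UNIV - {0}. \<Prod>i\<in>S. (s ^^ i) (linearized s c x / x)) = - permanent S (dickson s c)"
        unfolding s_def by (rule sum_prod_frobenius_ratio[OF q card S False])
      moreover have "(\<Sum>x\<in>UNIV - {0}. \<Prod>i\<in>S. (s ^^ i) (linearized s c x / x)) =
          - (\<Sum>y\<in>{linearized s c x / x | x. x \<noteq> 0}. \<Prod>i\<in>S. (s ^^ i) y)"
        by (rule sum_ratio_eq_sum_image[OF linearized_add])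
      ultimately show ?thesis by (rule trans[OF sym])
    qed
    then have "- permanent S (dickson s a) = - permanent S (dickson s b)" by (simp only: eq)
    then show ?thesis by (simp only: neg_equal_iff_equal)
  qed (simp add: permanent_def)
qed


section \<open>Linear maps of the plane and monomial images of graphs\<close>

lemma field_automorphism_id: "field_automorphism (id :: 'a::field \<Rightarrow> 'a)"
  by (simp add: field_automorphism_def)

text \<open>Linear maps, with the identity as companion automorphism, supply all witnesses
  below.\<close>

lemma linear_map_GammaL2:
  fixes a b c d :: "'a::field"
  assumes "a * d \<noteq> b * c"
  obtains \<phi> where "\<phi> \<in> GammaL2" "\<And>F x. k_map \<phi> F x = a * x + b * F x" "\<And>F x. h_map \<phi> F x = c * x + d * F x"
proof -
  define A :: "'a ^ 2 ^ 2" where "A = vector [vector [a, b], vector [c, d]]"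
  define \<phi> where "\<phi> = (\<lambda>v. A *v (\<chi> i. id (v $ i)))"
  have "det A \<noteq> 0" using assms by (simp add: A_def det_2)
  then have "invertible A" by (simp add: invertible_det_nz)
  then have "\<phi> \<in> GammaL2"
    unfolding GammaL2_def \<phi>_def using field_automorphism_id by blast
  then show thesis
    using that[of \<phi>] semilinear_coordinates[OF \<phi>_def] by (simp add: A_def)
qed

lemma transformed_eq_monomial:
  assumes "bij (k_map \<phi> F)" "\<And>x. h_map \<phi> F x = c * k_map \<phi> F x ^ m"
  shows "transformed \<phi> F y = c * y ^ m"
  using assms by (simp add: transformed_def bij_is_surj surj_f_inv_f)

theorem theorem1p4:
  fixes q :: nat and f g :: "'a::{field, finite} poly"
  assumes "primepow q"
    and "CARD('a) = q ^ 5"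
    and "q_polynomial q 5 f"
    and "q_polynomial q 5 g"
    and "max_field_of_linearity q 5 f = subfield_of_degree q 1"
    and "max_field_of_linearity q 5 g = subfield_of_degree q 1"
    and "im_ratio f = im_ratio g"
  shows "(\<exists>\<phi>\<in>GammaL2. bij (k_map \<phi> (poly f)) \<and> bij (k_map \<phi> (poly g)) \<and>
            (\<exists>i\<in>{1,2,3,4::nat}. \<exists>j\<in>{1,2,3,4::nat}. \<exists>\<alpha> \<beta>.
               \<alpha> \<noteq> 0 \<and> \<beta> \<noteq> 0 \<and> field_norm q 5 \<alpha> = field_norm q 5 \<beta> \<and>
               (\<forall>x. transformed \<phi> (poly f) x = \<alpha> * x ^ (q ^ i)) \<and>
               (\<forall>x. transformed \<phi> (poly g) x = \<beta> * x ^ (q ^ j))))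
       \<or> (\<exists>\<mu>. \<mu> \<noteq> 0 \<and>
            ((\<forall>x. poly g x = poly f (\<mu> * x) / \<mu>) \<or>
             (\<forall>x. poly g x = poly (adjoint_poly q 5 f) (\<mu> * x) / \<mu>)))"
    (is "?monomial \<or> ?gauge")
proof -
  define s where "s = (\<lambda>x::'a. x ^ q)"
  interpret cyclic5 s unfolding s_def by (rule frobenius_cyclic5[OF assms(1,2)])
  have q1: "1 < q" using primepow_gt_Suc_0[OF assms(1)] by simp
  have pow: "(s ^^ i) x = x ^ (q ^ i)" for i x unfolding s_def by (rule frobenius_funpow)
  have norm: "field_norm q 5 x = orbit_norm s x" for x
    unfolding field_norm_def power_sum sum_less_5 power_add orbit_norm_def
    by (simp flip: pow add: funpow_numerals s_def)
  obtain a b where a: "f = (\<Sum>i<5. monom (a i) (q ^ i))" and b: "g = (\<Sum>i<5. monom (b i) (q ^ i))"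
    using assms(3,4) by (auto simp: q_polynomial_def)
  have polyf: "poly f x = linearized s a x" and polyg: "poly g x = linearized s b x" for x
    by (simp_all add: a b poly_sum poly_monom linearized_def pow)
  have im: "{linearized s a x / x | x. x \<noteq> 0} = {linearized s b x / x | x. x \<noteq> 0}"
    using assms(7) by (simp add: im_ratio_def polyf polyg)
  \<comment> \<open>A singleton index set gives a diagonal entry, so the coefficients of x
    agree.\<close>
  have "permanent {0} (dickson s a) = permanent {0} (dickson s b)"
    using same_permanents_of_image_eq[OF assms(1,2) im[unfolded s_def], folded s_def]
    by (simp add: same_permanents_def)
  then have ab0: "b 0 = a 0" by (simp add: permanent_0 dickson_def)
  \<comment> \<open>Removing the common multiple of x translates both image sets by the same amount,
    so they stay equal.\<close>
  define a' where "a' = a(0 := 0)"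
  define b' where "b' = b(0 := 0)"
  have F: "linearized s a x = a 0 * x + linearized s a' x" for x
    by (simp add: linearized_def sum_less_5 a'_def)
  have G: "linearized s b x = a 0 * x + linearized s b' x" for x
    by (simp add: linearized_def sum_less_5 b'_def ab0)
  have im': "{linearized s a' x / x | x. x \<noteq> 0} = {linearized s b' x / x | x. x \<noteq> 0}"
  proof -
    have "{linearized s a x / x | x. x \<noteq> 0} = (\<lambda>y. a 0 + y) ` {linearized s a' x / x | x. x \<noteq> 0}"
      by (auto simp: F add_divide_distrib image_iff)
    moreover have "{linearized s b x / x | x. x \<noteq> 0} = (\<lambda>y. a 0 + y) ` {linearized s b' x / x | x. x \<noteq> 0}"
      by (auto simp: G add_divide_distrib image_iff)
    ultimately show ?thesis using im by (simp add: inj_image_eq_iff)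
  qed
  have same: "same_permanents s a' b'"
    using same_permanents_of_image_eq[OF assms(1,2) im'[unfolded s_def]] by (simp add: s_def)
  \<comment> \<open>Otherwise the polynomial is multiplication by \<open>a 0\<close> and linear over
    the whole field, against the assumed maximum field of linearity.\<close>
  have nonzero: "c 1 \<noteq> 0 \<or> c 2 \<noteq> 0 \<or> c 3 \<noteq> 0 \<or> c 4 \<noteq> 0"
    if max: "max_field_of_linearity q 5 p = subfield_of_degree q 1"
      and p: "\<And>x. poly p x = a 0 * x + linearized s c x" and c0: "c 0 = 0" for p :: "'a poly" and c
  proof (rule ccontr)
    assume "\<not> ?thesis"
    then have "poly p x = a 0 * x" for x by (simp add: p c0 linearized_def sum_less_5)
    then have lin: "linear_over K p" for K by (simp add: linear_over_def mult_ac)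
    have "(GREATEST m. m dvd 5 \<and> linear_over (subfield_of_degree q m) p) = 5"
      by (rule Greatest_equality) (auto simp: lin intro: dvd_imp_le)
    then have "subfield_of_degree q 5 = (subfield_of_degree q 1 :: 'a set)"
      using max by (simp add: max_field_of_linearity_def)
    moreover have "subfield_of_degree q 5 = (UNIV :: 'a set)"
      using s_pow_5 by (simp add: subfield_of_degree_def pow)
    ultimately have "x ^ q = x" for x :: 'a
      by (auto simp: subfield_of_degree_def)
    then have "[q = 1] (mod (CARD('a) - 1))" by (intro cong_of_power_eq) simp
    then have "q ^ 5 - 1 dvd q - 1" using q1 by (simp add: assms(2) cong_altdef_nat)
    then have "q ^ 5 - 1 \<le> q - 1" using q1 by (intro dvd_imp_le) simp_all
    moreover have "q ^ 1 < q ^ 5" using q1 by (intro power_strict_increasing) simp_all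
    ultimately show False using q1 by simp
  qed
  \<comment> \<open>On each graph the second new coordinate is a function of the first, so by
    \<open>inj\<close> the first determines the point; finiteness then gives bijectivity.\<close>
  have monomialI: ?monomial
    if asm: "\<alpha> \<noteq> 0" "\<beta> \<noteq> 0" "orbit_norm s \<alpha> = orbit_norm s \<beta>" "i \<in> {1,2,3,4}" "j \<in> {1,2,3,4}"
      and det: "k1 * h2 \<noteq> k2 * h1"
      and inj: "\<And>F x y. k1 * x + k2 * F x = k1 * y + k2 * F y \<Longrightarrow> h1 * x + h2 * F x = h1 * y + h2 * F y \<Longrightarrow> x = y"
      and f: "\<And>x. h1 * x + h2 * poly f x = \<alpha> * (s ^^ i) (k1 * x + k2 * poly f x)"
      and g: "\<And>x. h1 * x + h2 * poly g x = \<beta> * (s ^^ j) (k1 * x + k2 * poly g x)"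
    for \<alpha> \<beta> i j k1 k2 h1 h2
  proof -
    obtain \<phi> where \<phi>: "\<phi> \<in> GammaL2" "\<And>F x. k_map \<phi> F x = k1 * x + k2 * F x"
      "\<And>F x. h_map \<phi> F x = h1 * x + h2 * F x"
      using linear_map_GammaL2[OF det] by blast
    have bij: "bij (k_map \<phi> F)" if "\<And>x. h1 * x + h2 * F x = \<gamma> * (s ^^ i) (k1 * x + k2 * F x)" for F \<gamma> i
    proof -
      have "inj (k_map \<phi> F)"
      proof (rule injI)
        fix x y assume "k_map \<phi> F x = k_map \<phi> F y"
        then have e: "k1 * x + k2 * F x = k1 * y + k2 * F y" by (simp only: \<phi>(2))
        show "x = y" by (rule inj[OF e]) (simp only: that e)
      qed
      then show ?thesis using finite_UNIV_inj_surj[of "k_map \<phi> F"] by (simp add: bij_def)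
    qed
    have "transformed \<phi> (poly f) x = \<alpha> * x ^ (q ^ i)" for x
      by (rule transformed_eq_monomial[OF bij[OF f]]) (simp only: \<phi>(2,3) f pow)
    moreover have "transformed \<phi> (poly g) x = \<beta> * x ^ (q ^ j)" for x
      by (rule transformed_eq_monomial[OF bij[OF g]]) (simp only: \<phi>(2,3) g pow)
    ultimately show ?thesis
      using asm(1-5) \<phi>(1) bij[OF f] bij[OF g] unfolding norm by blast
  qed
  have z: "a' 0 = 0" "b' 0 = 0" by (simp_all add: a'_def b'_def)
  have "gauge_or_adjoint a' b' \<or> both_monomial s a' b' \<or> (\<exists>t. single_coeff s t a' \<and> single_coeff s t b')"
  proof (rule same_permanents_cases[OF same z])
    show "a' 1 \<noteq> 0 \<or> a' 2 \<noteq> 0 \<or> a' 3 \<noteq> 0 \<or> a' 4 \<noteq> 0"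
      by (rule nonzero[OF assms(5)]) (simp_all only: polyf F z)
    show "b' 1 \<noteq> 0 \<or> b' 2 \<noteq> 0 \<or> b' 3 \<noteq> 0 \<or> b' 4 \<noteq> 0"
      by (rule nonzero[OF assms(6)]) (simp_all only: polyg G z)
  qed
  then consider "gauge_or_adjoint a' b'" | "both_monomial s a' b'" | t where "single_coeff s t a'" "single_coeff s t b'"
    by blast
  then show ?thesis
  proof cases
    case 1
    have scale: "linearized s d x = linearized s c (l * x) / l"
      if "l \<noteq> 0" "\<And>k. k < 5 \<Longrightarrow> d k = c k * (s ^^ k) l / l" for c d l x
      using that by (simp add: linearized_def sum_divide_distrib s_pow_mult mult_ac)
    \<comment> \<open>Rescaling never changes coefficient 0, so the removed term can be put
      back.\<close>
    have extend: "\<exists>l. l \<noteq> 0 \<and> (\<forall>k<5. b k = c k * (s ^^ k) l / l)"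
      if c: "gauge_equiv s (c(0 := 0)) b'" "c 0 = a 0" for c
    proof -
      obtain l where l: "l \<noteq> 0" "\<And>k. k < 5 \<Longrightarrow> b' k = (c(0 := 0)) k * (s ^^ k) l / l"
        using c(1) by (auto simp: gauge_equiv_def)
      have "b k = c k * (s ^^ k) l / l" if "k < 5" for k
      proof (cases "k = 0")
        case True
        then show ?thesis using c(2) ab0 l(1) by simp
      next
        case False
        then show ?thesis using l(2)[OF that] by (simp only: b'_def fun_upd_apply if_False)
      qed
      then show ?thesis using l(1) by blast
    qed
    have adj: "poly (adjoint_poly q 5 f) x = linearized s (adjoint_coeffs s a) x" for x
    proof -
      have "coeff f (q ^ i) = a i" if "i < 5" for i
        using q1 that by (simp add: a coeff_sum coeff_monom power_inject_exp if_distrib sum.delta' cong: if_cong)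
      then show ?thesis
        by (simp add: adjoint_poly_def poly_sum poly_monom linearized_def sum_less_5 adjoint_coeffs_def pow)
    qed
    have "\<forall>k<5. ((adjoint_coeffs s a)(0 := 0)) k = adjoint_coeffs s a' k"
      unfolding all_less_5 by (simp add: adjoint_numerals a'_def)
    then have adj0: "gauge_equiv s (adjoint_coeffs s a') b' \<longleftrightarrow> gauge_equiv s ((adjoint_coeffs s a)(0 := 0)) b'"
      by (intro gauge_equiv_cong) simp_all
    from 1 consider "gauge_equiv s a' b'" | "gauge_equiv s ((adjoint_coeffs s a)(0 := 0)) b'"
      using gauge_equiv_adjoint adj0 by (auto simp: gauge_or_adjoint_def)
    then have ?gauge
    proof cases
      case 1
      then obtain l where "l \<noteq> 0" "\<forall>k<5. b k = a k * (s ^^ k) l / l"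
        using extend[of a] by (auto simp: a'_def)
      then show ?thesis using scale[of l b a] by (auto simp: polyf polyg)
    next
      case 2
      then obtain l where "l \<noteq> 0" "\<forall>k<5. b k = adjoint_coeffs s a k * (s ^^ k) l / l"
        using extend[of "adjoint_coeffs s a"] by (auto simp: adjoint_numerals)
      then show ?thesis using scale[of l b "adjoint_coeffs s a"] by (auto simp: polyg adj)
    qed
    then show ?thesis ..
  next
    case 2
    then obtain n t c d i j where n: "n \<noteq> 0" "t \<noteq> 0" "t \<noteq> 1" and ij: "i \<in> {1,2,3,4}" "j \<in> {1,2,3,4}"
      and norms: "orbit_norm s c = t" "orbit_norm s d = t"
      and fc: "\<And>x. t * x + n * linearized s a' x = c * (s ^^ i) (x + n * linearized s a' x)"
      and gd: "\<And>x. t * x + n * linearized s b' x = d * (s ^^ j) (x + n * linearized s b' x)"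
      unfolding both_monomial_def monomial_via_def by blast
    have ?monomial
    \<comment> \<open>The entries \<open>1 - n * a 0\<close> and \<open>t - n * a 0\<close> absorb
      the multiple of x by which \<open>poly f\<close> and \<open>poly g\<close> exceed the reduced
      polynomials.\<close>
    proof (rule monomialI[where ?k1.0 = "1 - n * a 0" and ?k2.0 = n and ?h1.0 = "t - n * a 0" and ?h2.0 = n])
      show "c \<noteq> 0" "d \<noteq> 0" using norms n by (auto simp: orbit_norm_def)
      show "orbit_norm s c = orbit_norm s d" by (simp only: norms)
      show "(1 - n * a 0) * n \<noteq> n * (t - n * a 0)" using n by (simp add: mult.commute)
      show "x = y" if "(1 - n * a 0) * x + n * F x = (1 - n * a 0) * y + n * F y"
        "(t - n * a 0) * x + n * F x = (t - n * a 0) * y + n * F y" for x y and F :: "'a \<Rightarrow> 'a"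
      proof -
        have "(t - 1) * (x - y) = 0" using that by algebra
        then show ?thesis using n by simp
      qed
      have shift: "(u - n * a 0) * x + n * (a 0 * x + y) = u * x + n * y" for u x y
        by (simp add: algebra_simps)
      show "(t - n * a 0) * x + n * poly f x = c * (s ^^ i) ((1 - n * a 0) * x + n * poly f x)" for x
        unfolding polyf F shift mult_1 by (rule fc)
      show "(t - n * a 0) * x + n * poly g x = d * (s ^^ j) ((1 - n * a 0) * x + n * poly g x)" for x
        unfolding polyg G shift mult_1 by (rule gd)
    qed (rule ij)+
    then show ?thesis ..
  next
    case 3
    then obtain i j where ij: "i \<in> {1,2,3,4}" "j \<in> {1,2,3,4}" and nz: "a' i \<noteq> 0" "b' j \<noteq> 0"
      and norms: "orbit_norm s (a' i) = orbit_norm s (b' j)"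
      and fc: "\<And>x. linearized s a' x = a' i * (s ^^ i) x"
      and gd: "\<And>x. linearized s b' x = b' j * (s ^^ j) x"
      unfolding single_coeff_def by metis
    have ?monomial
    \<comment> \<open>A shear removing \<open>a 0 * x\<close> already leaves one monomial on each
      side.\<close>
    proof (rule monomialI[where ?k1.0 = 1 and ?k2.0 = 0 and ?h1.0 = "- a 0" and ?h2.0 = 1])
      show "- a 0 * x + 1 * poly f x = a' i * (s ^^ i) (1 * x + 0 * poly f x)" for x
        by (simp add: polyf F fc)
      show "- a 0 * x + 1 * poly g x = b' j * (s ^^ j) (1 * x + 0 * poly g x)" for x
        by (simp add: polyg G gd)
    qed (use nz norms ij in simp_all)
    then show ?thesis ..
  qed
qed

end
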